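(* Let $r\in\{1,2\}$ and let $f_{\gamma_d}$ be the probability density function of the instantaneous SNR $\gamma_d$ of the destination link defined in the context. Then the average channel capacity $$\mathrm{ACC}=\frac{1}{2\ln 2}\int_0^\infty\ln(1+\gamma)\,f_{\gamma_d}(\gamma)\,d\gamma$$ equals $$\mathrm{ACC}=\frac{\Lambda_{1,d}\,\mu_{r,d}^{-l_d/r}}{2\ln(2)\,r^{1/2}(2\pi)^{\frac{r-1}{2}}}\;G_{2,r+2}^{r+2,1}\left[\frac{\Lambda_{2,d}^{r}}{\mu_{r,d}\,r^{r}}\,\middle|\,\begin{array}{c}-\frac{l_d}{r},\,1-\frac{l_d}{r}\\ 0,\frac{r-1}{r},-\frac{l_d}{r},-\frac{l_d}{r}\end{array}\right].$$
   Context: Meijer's G function: $G^{m,n}_{p,q}\left[z\,\middle|\,\begin{array}{c}a_1,\dots,a_p\\ b_1,\dots,b_q\end{array}\right]=\frac{1}{2\pi i}\int_{L}\frac{\prod_{i=1}^{m}\Gamma(b_i+s)\prod_{i=1}^{n}\Gamma(1-a_i-s)}{\prod_{i=n+1}^{p}\Gamma(a_i+s)\prod_{i=m+1}^{q}\Gamma(1-b_i-s)}z^{-s}\,ds$, where $L$ separates the poles of the $\Gamma(b_i+s)$ ($i\le m$) from those of the $\Gamma(1-a_i-s)$ ($i\le n$). In a parameter list, "$0,\frac{r-1}{r}$" denotes the single entry $0$ if $r=1$, and $0,\frac12$ if $r=2$. Model. $M$ is a positive random variable (the two-hop channel gain through one reflecting element of the reconfigurable intelligent surface: a product of two independent inverted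 Gamma-Gamma turbulence variables with pointing errors) with mean $E=\mathbb{E}(M)>0$ and variance $0<\mathrm{Var}(M)<\infty$; only $E$ and $\mathrm{Var}(M)$ enter. $N_d\ge1$ is the number of reflecting elements, $l_d=N_dE^2/\mathrm{Var}(M)$, $k_d=\mathrm{Var}(M)/E$. The sum of the $N_d$ gains is modelled by $\bar M_d$ with density $\frac{y^{l_d-1}}{\Gamma(l_d)k_d^{l_d}}e^{-y/k_d}$, $y>0$. The instantaneous SNR is $\gamma_d=\mu_{r,d}(\bar M_d/E)^r$, where $\mu_{r,d}>0$ is the electrical SNR and $r$ is the detection type ($r=1$ heterodyne, $r=2$ intensity modulation/direct detection). Constants: $\Lambda_{1,d}=\frac{E^{l_d}}{\Gamma(l_d)k_d^{l_d}}$, $\Lambda_{2,d}=\frac{E}{k_d}$. *)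

theory Defs
  imports "HOL-Probability.Probability" "HOL-Complex_Analysis.Complex_Analysis"
begin

section \<open>Meijer's G function\<close>

text \<open>
  The orders \<open>p\<close> and \<open>q\<close> are the lengths of the parameter lists \<open>as\<close> and \<open>bs\<close>; the informal
  \<open>a_i\<close> is \<open>as ! (i - 1)\<close>. The library's \<^const>\<open>Gamma\<close> vanishes at its poles, so by \<open>x / 0 = 0\<close>
  the factors in the denominator act as the entire function \<open>1 / Gamma\<close> everywhere. At the poles
  of the numerator the value is meaningless, but the contours below avoid these points.
\<close>

definition meijer_integrand ::
  "nat \<Rightarrow> nat \<Rightarrow> complex list \<Rightarrow> complex list \<Rightarrow> complex \<Rightarrow> complex \<Rightarrow> complex" where
  "meijer_integrand m n as bs z s =
     ((\<Prod>i<m. Gamma (bs ! i + s)) * (\<Prod>i<n. Gamma (1 - as ! i - s))) /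
     ((\<Prod>i=n..<length as. Gamma (as ! i + s)) * (\<Prod>i=m..<length bs. Gamma (1 - bs ! i - s)))
     * z powr (- s)"

definition meijer_poles_b :: "nat \<Rightarrow> complex list \<Rightarrow> complex set" where
  "meijer_poles_b m bs = {s. \<exists>i<m. bs ! i + s \<in> \<int>\<^sub>\<le>\<^sub>0}"

definition meijer_poles_a :: "nat \<Rightarrow> complex list \<Rightarrow> complex set" where
  "meijer_poles_a n as = {s. \<exists>i<n. 1 - as ! i - s \<in> \<int>\<^sub>\<le>\<^sub>0}"

text \<open>
  Contours run from \<open>c - i \<infinity>\<close> to \<open>c + i \<infinity>\<close>: simple, piecewise continuously differentiable, and
  equal to the vertical line \<open>Re s = c\<close> outside a compact set, so that they may be indented to
  separate the poles. A point off such a contour lies to its left iff the winding number of the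
  part over \<open>[-T, T]\<close> (an open arc) tends to \<open>1/2\<close>, and to its right iff it tends to \<open>-1/2\<close>.
\<close>

definition mellin_barnes_contour :: "(real \<Rightarrow> complex) \<Rightarrow> bool" where
  "mellin_barnes_contour L \<longleftrightarrow>
     inj L \<and>
     (\<forall>T>0. L piecewise_C1_differentiable_on {-T..T}) \<and>
     (\<exists>c R. \<forall>t. \<bar>t\<bar> \<ge> R \<longrightarrow> L t = Complex c t)"

definition left_of_contour :: "(real \<Rightarrow> complex) \<Rightarrow> complex \<Rightarrow> bool" where
  "left_of_contour L p \<longleftrightarrow>
     p \<notin> range L \<and> ((\<lambda>T. winding_number (\<lambda>u. L (T * (2 * u - 1))) p) \<longlongrightarrow> 1 / 2) at_top"

definition right_of_contour :: "(real \<Rightarrow> complex) \<Rightarrow> complex \<Rightarrow> bool" where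
  "right_of_contour L p \<longleftrightarrow>
     p \<notin> range L \<and> ((\<lambda>T. winding_number (\<lambda>u. L (T * (2 * u - 1))) p) \<longlongrightarrow> - 1 / 2) at_top"

definition meijer_contour ::
  "nat \<Rightarrow> nat \<Rightarrow> complex list \<Rightarrow> complex list \<Rightarrow> (real \<Rightarrow> complex) \<Rightarrow> bool" where
  "meijer_contour m n as bs L \<longleftrightarrow>
     mellin_barnes_contour L \<and>
     (\<forall>p\<in>meijer_poles_b m bs. left_of_contour L p) \<and>
     (\<forall>p\<in>meijer_poles_a n as. right_of_contour L p)"

text \<open>
  The value is determined only if some separating contour has a convergent integral and all
  such contours give the same value.
\<close>

definition meijer_G ::
  "nat \<Rightarrow> nat \<Rightarrow> complex list \<Rightarrow> complex list \<Rightarrow> complex \<Rightarrow> complex" where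
  "meijer_G m n as bs z =
     (THE w. \<exists>L. meijer_contour m n as bs L \<and>
        (\<exists>I. ((\<lambda>t. meijer_integrand m n as bs z (L t) * vector_derivative L (at t))
               has_integral I) UNIV \<and>
             w = 1 / (2 * of_real pi * \<i>) * I))"

section \<open>Channel model\<close>

definition gamma_density :: "real \<Rightarrow> real \<Rightarrow> real \<Rightarrow> real" where
  "gamma_density l k y =
     (if y > 0 then y powr (l - 1) / (Gamma l * k powr l) * exp (- y / k) else 0)"

definition avg_channel_capacity :: "(real \<Rightarrow> real) \<Rightarrow> real" where
  "avg_channel_capacity f = 1 / (2 * ln 2) * (LINT x:{0<..}|lborel. ln (1 + x) * f x)"

end

theory Submission
  imports Defs "HOL-Real_Asymp.Real_Asymp"
begin

text \<open>
  On the line \<open>Re u = 1/2\<close> one has \<open>pi / sin (pi u) = pi / cosh (pi t)\<close>, and the Fourier transform of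
  \<open>1 / cosh\<close> is known from the residue theorem on a rectangle of height one. Integrating it gives
  \<open>ln (1 + x)\<close> as the inverse Mellin transform of \<open>pi / (u sin (pi u))\<close>. By Fubini, the expectation
  of \<open>ln (1 + \<gamma>)\<close> becomes a line integral of the moments \<open>Gamma (l + r u) / Gamma l\<close>; for \<open>r = 2\<close>
  Legendre's duplication splits these into the two Gamma factors of the G function, and the
  remaining factors combine by \<open>Gamma (u + 1) = u Gamma u\<close> and the reflection formula, where
  \<open>u = s - l / r\<close>.

  The G function is only defined if all separating contours agree. All poles are real, so the
  winding numbers around them of a contour closed up along the line are differences of logarithms
  and vanish; the homological Cauchy theorem applies, and the integrand decays along horizontal
  segments.
\<close>



section \<open>Contours with vertical tails\<close>

text \<open>In \<open>u = s - a\<close> with \<open>a = l / r\<close>, one family of poles lies in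
  \<open>u \<le> 0\<close> and the other in \<open>u \<ge> 1\<close>. The strip between them has
  width one, and its midline \<open>Re u = 1/2\<close> is \<open>Re s = a + 1/2\<close>. There
  \<open>pi / (u sin (pi u))\<close> has modulus at most \<open>2 pi / cosh (pi t)\<close>. This
  exponential decay pays for every estimate: about \<open>Gamma\<close> it suffices to know
  boundedness on strips away from the real axis, and \<open>\<zeta>\<close> may be any positive
  number.

  The delicate point is the competing contour \<open>L\<close>. Its tails may lie at any abscissa
  \<open>c\<close>, even beyond some of the poles; it may cross the midline many times; its integral
  may converge only conditionally; and its position relative to a pole is known only as a limit of
  winding numbers of open arcs. Hence everything is compared at a finite height \<open>T\<close>,
  where \<open>L\<close> is closed up by horizontal edges and the midline, and only then
  \<open>T\<close> grows.

  The density of the SNR is never put in closed form: expectations are carried over to the Gamma law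
  of \<open>Mbar\<close> through the probability space.\<close>

lemma has_contour_integral_symmetric_iff:
  assumes T: "T > 0" and L: "L piecewise_C1_differentiable_on {-T..T}"
  shows "(f has_contour_integral I) (\<lambda>u. L (T * (2 * u - 1))) \<longleftrightarrow>
    ((\<lambda>t. f (L t) * vector_derivative L (at t)) has_integral I) {-T..T}"
proof -
  obtain S where S: "finite S" "L C1_differentiable_on ({-T..T} - S)"
    using L by (auto simp: piecewise_C1_differentiable_on_def)
  define h where "h = (\<lambda>t. f (L t) * vector_derivative L (at t))"
  define S' where "S' = (\<lambda>t. (t + T) / (2 * T)) ` S"
  have deriv: "vector_derivative (\<lambda>u. L (T * (2 * u - 1))) (at u)
      = (2 * T) *\<^sub>R vector_derivative L (at (T * (2 * u - 1)))"
    if u: "u \<in> {0..1} - S'" for u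
  proof -
    let ?t = "T * (2 * u - 1)"
    have "?t \<in> {-T..T}" using u T by (simp add: algebra_simps)
    moreover have "?t \<notin> S"
      using u T unfolding S'_def by (auto simp: image_iff field_simps)
    ultimately have "L differentiable at ?t"
      using S(2) by (auto simp: C1_differentiable_on_eq)
    then have 1: "(L has_vector_derivative vector_derivative L (at ?t)) (at ?t)"
      by (simp add: vector_derivative_works)
    have 2: "((\<lambda>u. T * (2 * u - 1)) has_vector_derivative (2 * T)) (at u)"
      by (auto intro!: derivative_eq_intros simp flip: has_real_derivative_iff_has_vector_derivative)
    show ?thesis
      using vector_diff_chain_at[OF 2 1] by (simp add: o_def vector_derivative_at)
  qed
  have "(f has_contour_integral I) (\<lambda>u. L (T * (2 * u - 1))) \<longleftrightarrow>
    ((\<lambda>u. f (L (T * (2 * u - 1))) * vector_derivative (\<lambda>u. L (T * (2 * u - 1))) (at u))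
       has_integral I) {0..1}"
    by (simp add: has_contour_integral)
  also have "\<dots> \<longleftrightarrow> ((\<lambda>u. (2 * T) *\<^sub>R h (T * (2 * u - 1))) has_integral I) {0..1}"
    by (rule has_integral_spike_finite_eq[of S'])
       (use S deriv in \<open>auto simp: S'_def h_def scaleR_conv_of_real\<close>)
  also have "\<dots> \<longleftrightarrow> ((\<lambda>u. h (T * (2 * u - 1))) has_integral (I /\<^sub>R (2 * T))) {0..1}"
    using T has_integral_cmul[of "\<lambda>u. (2 * T) *\<^sub>R h (T * (2 * u - 1))" I "{0..1}" "inverse (2*T)"]
      has_integral_cmul[of "\<lambda>u. h (T * (2 * u - 1))" "I /\<^sub>R (2 * T)" "{0..1}" "2*T"]
    by auto
  also have "\<dots> \<longleftrightarrow> (h has_integral I) {-T..T}"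
    using has_integral_affinity_iff[of "2*T" h "-T" I "-T" T] T
    by (simp add: algebra_simps)
  finally show ?thesis by (simp add: h_def)
qed

lemma valid_path_symmetric:
  assumes L: "L piecewise_C1_differentiable_on {-T..T}" and T: "T > 0"
  shows "valid_path (\<lambda>u. L (T * (2 * u - 1)))"
proof -
  have "(\<lambda>u. 2 * T * u + - T) ` {0..1} \<subseteq> {-T..T}"
    using T by (auto simp: algebra_simps)
  then have "(L \<circ> (\<lambda>u. (2 * T) *\<^sub>R u + - T)) piecewise_C1_differentiable_on {0..1}"
    by (intro piecewise_C1_differentiable_affine piecewise_C1_differentiable_on_subset[OF L])
  then show ?thesis
    by (simp add: valid_path_def o_def algebra_simps)
qed

section \<open>Winding numbers around real points by logarithms\<close>

text \<open>\<open>Ln (\<sigma> * (z - p))\<close> is a primitive of \<open>1 / (z - p)\<close> for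
  every nonzero \<open>\<sigma>\<close>. For real \<open>p\<close>, the sign
  \<open>\<sigma> = 1\<close> puts the branch cut to the left of \<open>p\<close> and
  \<open>\<sigma> = -1\<close> to its right, so a path meeting the real axis on one side of
  \<open>p\<close> only can always be served.\<close>

lemma has_contour_integral_inverse_Ln:
  assumes g: "valid_path g" and \<sigma>: "\<sigma> \<noteq> 0"
    and slit: "\<And>z. z \<in> path_image g \<Longrightarrow> \<sigma> * (z - p) \<notin> \<real>\<^sub>\<le>\<^sub>0"
  shows "((\<lambda>z. 1 / (z - p)) has_contour_integral
    Ln (\<sigma> * (pathfinish g - p)) - Ln (\<sigma> * (pathstart g - p))) g"
proof (rule contour_integral_primitive[OF _ g subset_refl])
  fix z assume z: "z \<in> path_image g"
  then have "\<sigma> * (z - p) \<noteq> 0" using slit[OF z] by auto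
  then show "((\<lambda>z. Ln (\<sigma> * (z - p))) has_field_derivative 1 / (z - p)) (at z within path_image g)"
    using slit[OF z] \<sigma> by (auto intro!: derivative_eq_intros simp: field_simps)
qed

text \<open>Factoring out \<open>T > 0\<close> gives \<open>Ln (T w) = Ln w + ln T\<close>. The two
  terms \<open>ln T\<close> cancel in the difference, and what remains tends to
  \<open>Ln (\<sigma> \<i>) - Ln (- \<sigma> \<i>)\<close>.\<close>

lemma Ln_difference_tendsto:
  fixes p c \<sigma> :: real
  assumes \<sigma>: "\<sigma> = 1 \<or> \<sigma> = -1"
  shows "((\<lambda>T. Ln (\<sigma> * (Complex c T - p)) - Ln (\<sigma> * (Complex c (-T) - p))) \<longlongrightarrow> \<sigma> * pi * \<i>) at_top"
proof -
  define x where "x = \<sigma> * (c - p)"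
  have lim: "((\<lambda>T. Ln (Complex (x / T) s)) \<longlongrightarrow> Ln (Complex 0 s)) at_top" if "s \<noteq> 0" for s
  proof -
    have "((\<lambda>T. x / T) \<longlongrightarrow> 0) at_top"
      by (rule tendsto_divide_0[OF tendsto_const filterlim_at_top_imp_at_infinity[OF filterlim_ident]])
    then have "((\<lambda>T. Complex (x / T) s) \<longlongrightarrow> Complex 0 s) at_top"
      by (intro tendsto_Complex tendsto_const)
    then show ?thesis
      using that by (intro tendsto_Ln) (auto simp: complex_nonpos_Reals_iff)
  qed
  have eq: "Ln (Complex x (s * T)) = Ln (Complex (x / T) s) + ln T" if "T > 0" "s \<noteq> 0" for T s
  proof -
    have "Complex x (s * T) = of_real T * Complex (x / T) s"
      using that by (simp add: complex_eq_iff)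
    moreover have "Complex (x / T) s \<noteq> 0"
      using that by (simp add: complex_eq_iff)
    ultimately show ?thesis
      using that by (simp add: Ln_times_of_real Ln_of_real)
  qed
  have "((\<lambda>T. Ln (Complex (x / T) \<sigma>) - Ln (Complex (x / T) (-\<sigma>))) \<longlongrightarrow>
      Ln (Complex 0 \<sigma>) - Ln (Complex 0 (-\<sigma>))) at_top"
    using \<sigma> by (intro tendsto_diff lim) auto
  moreover have "Ln (Complex 0 \<sigma>) - Ln (Complex 0 (-\<sigma>)) = \<sigma> * pi * \<i>"
  proof -
    have "Complex 0 1 = \<i>" "Complex 0 (-1) = - \<i>" by (simp_all add: complex_eq_iff)
    then show ?thesis using \<sigma> by (elim disjE) simp_all
  qed
  ultimately have "((\<lambda>T. Ln (Complex (x / T) \<sigma>) - Ln (Complex (x / T) (-\<sigma>))) \<longlongrightarrow> \<sigma> * pi * \<i>) at_top"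
    by simp
  then show ?thesis
  proof (rule Lim_transform_eventually)
    show "\<forall>\<^sub>F T in at_top. Ln (Complex (x / T) \<sigma>) - Ln (Complex (x / T) (-\<sigma>)) =
        Ln (\<sigma> * (Complex c T - p)) - Ln (\<sigma> * (Complex c (-T) - p))"
      using eventually_gt_at_top[of 0]
    proof eventually_elim
      case (elim T)
      have "of_real \<sigma> * (Complex c T - p) = Complex x (\<sigma> * T)"
        "of_real \<sigma> * (Complex c (-T) - p) = Complex x (-\<sigma> * T)"
        by (simp_all add: complex_eq_iff x_def)
      then show ?case using eq[OF elim, of \<sigma>] eq[OF elim, of "-\<sigma>"] \<sigma> by auto
    qed
  qed
qed

text \<open>As \<open>0\<close> is excluded from the parameter interval, the tail stays off the real
  axis. Thus either branch is a primitive along it, whatever the order of \<open>c\<close> and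
  \<open>p\<close>.\<close>

lemma has_integral_vertical_inverse:
  fixes p c \<sigma> a b :: real and L :: "real \<Rightarrow> complex"
  assumes \<sigma>: "\<sigma> = 1 \<or> \<sigma> = -1" and ab: "a \<le> b" "0 \<notin> {a..b}"
    and L: "\<And>t. t \<in> {a..b} \<Longrightarrow> L t = Complex c t"
  shows "((\<lambda>t. 1 / (L t - p) * vector_derivative L (at t)) has_integral
    Ln (\<sigma> * (Complex c b - p)) - Ln (\<sigma> * (Complex c a - p))) {a..b}"
proof -
  have "((\<lambda>t. 1 / (Complex c t - p) * \<i>) has_integral
    Ln (\<sigma> * (Complex c b - p)) - Ln (\<sigma> * (Complex c a - p))) {a..b}"
  proof (rule fundamental_theorem_of_calculus[OF ab(1)])
    fix t assume t: "t \<in> {a..b}"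
    then have t0: "t \<noteq> 0" using ab by auto
    have "((\<lambda>t. of_real \<sigma> * (c + \<i> * complex_of_real t - p)) has_vector_derivative (of_real \<sigma> * \<i>)) (at t within {a..b})"
      by (auto intro!: derivative_eq_intros)
    moreover have "(Ln has_field_derivative 1 / (of_real \<sigma> * (Complex c t - p))) (at (of_real \<sigma> * (c + \<i> * complex_of_real t - p)))"
      using \<sigma> t0 by (auto intro!: derivative_eq_intros simp: Complex_eq complex_nonpos_Reals_iff inverse_eq_divide)
    ultimately show "((\<lambda>t. Ln (\<sigma> * (Complex c t - p))) has_vector_derivative
        1 / (Complex c t - p) * \<i>) (at t within {a..b})"
      using field_vector_diff_chain_within[of _ "of_real \<sigma> * \<i>" t "{a..b}" Ln "1 / (of_real \<sigma> * (Complex c t - p))"] \<sigma>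
      by (auto simp: o_def Complex_eq has_field_derivative_at_within)
  qed
  \<comment> \<open>Only in the interior: outside \<open>{a..b}\<close> nothing is known about
    \<open>L\<close>, so its derivative at the two endpoints may differ from \<open>\<i>\<close> or
    fail to exist. These two points are negligible.\<close>
  moreover have "vector_derivative L (at t) = \<i>" if t: "t \<in> {a<..<b}" for t
  proof (rule vector_derivative_at)
    have "((\<lambda>t. Complex c t) has_vector_derivative \<i>) (at t)"
      unfolding Complex_eq by (auto intro!: derivative_eq_intros)
    then show "(L has_vector_derivative \<i>) (at t)"
      by (rule has_vector_derivative_transform_within_open[of _ _ _ "{a<..<b}"])
        (use t L in auto)
  qed
  ultimately show ?thesis
    using has_integral_spike_finite[of "{a,b}" "{a..b}" "\<lambda>t. 1 / (L t - p) * vector_derivative L (at t)"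
        "\<lambda>t. 1 / (Complex c t - p) * \<i>"] L
    by auto
qed

lemma winding_number_symmetric:
  assumes L: "L piecewise_C1_differentiable_on {-T..T}" and T: "T > 0"
    and p: "p \<notin> range L"
  shows "((\<lambda>t. 1 / (L t - p) * vector_derivative L (at t)) has_integral
    2 * pi * \<i> * winding_number (\<lambda>u. L (T * (2 * u - 1))) p) {-T..T}"
proof -
  let ?g = "\<lambda>u. L (T * (2 * u - 1))"
  have "valid_path ?g" by (rule valid_path_symmetric[OF L T])
  moreover have "p \<notin> path_image ?g" using p by (auto simp: path_image_def)
  ultimately have "((\<lambda>w. 1 / (w - p)) has_contour_integral (2 * pi * \<i> * winding_number ?g p)) ?g"
    using has_contour_integral_winding_number by blast
  then show ?thesis
    by (subst (asm) has_contour_integral_symmetric_iff[OF T L])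
qed

text \<open>The winding number of a truncation is that of the vertical tails plus a quantity independent
  of the truncation, and the latter must vanish since both sides have the same limit.\<close>

lemma winding_number_truncated_contour:
  fixes p c \<sigma> T :: real
  assumes \<sigma>: "\<sigma> = 1 \<or> \<sigma> = -1"
    and L: "\<And>T. T > 0 \<Longrightarrow> L piecewise_C1_differentiable_on {-T..T}"
    and tail: "\<And>t. \<bar>t\<bar> \<ge> R \<Longrightarrow> L t = Complex c t"
    and p: "complex_of_real p \<notin> range L"
    and lim: "((\<lambda>T. winding_number (\<lambda>u. L (T * (2 * u - 1))) p) \<longlongrightarrow> \<sigma> / 2) at_top"
    and T: "T > 0" "T \<ge> R"
  shows "2 * pi * \<i> * winding_number (\<lambda>u. L (T * (2 * u - 1))) p =
    Ln (\<sigma> * (Complex c T - p)) - Ln (\<sigma> * (Complex c (-T) - p))"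
proof -
  define W where "W = (\<lambda>T. 2 * pi * \<i> * winding_number (\<lambda>u. L (T * (2 * u - 1))) p)"
  define D where "D = (\<lambda>T. Ln (\<sigma> * (Complex c T - p)) - Ln (\<sigma> * (Complex c (-T) - p)))"
  have const: "W T' - D T' = W T - D T" if T': "T' \<ge> T" for T'
  proof -
    let ?h = "\<lambda>t. 1 / (L t - p) * vector_derivative L (at t)"
    have "(?h has_integral Ln (\<sigma> * (Complex c T' - p)) - Ln (\<sigma> * (Complex c T - p))) {T..T'}"
      using T T' by (intro has_integral_vertical_inverse \<sigma> tail) auto
    moreover have "(?h has_integral Ln (\<sigma> * (Complex c (-T) - p)) - Ln (\<sigma> * (Complex c (-T') - p))) {-T'..-T}"
      using T T' by (intro has_integral_vertical_inverse \<sigma> tail) auto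
    moreover have "(?h has_integral W T) {-T..T}"
      unfolding W_def by (rule winding_number_symmetric[OF L[OF T(1)] T(1) p])
    ultimately have "(?h has_integral (Ln (\<sigma> * (Complex c (-T) - p)) - Ln (\<sigma> * (Complex c (-T') - p)))
        + W T + (Ln (\<sigma> * (Complex c T' - p)) - Ln (\<sigma> * (Complex c T - p)))) {-T'..T'}"
      using T T' by (intro has_integral_combine[of "-T'" T T'] has_integral_combine[of "-T'" "-T" T]) auto
    moreover have "(?h has_integral W T') {-T'..T'}"
      unfolding W_def using T T' by (intro winding_number_symmetric L p) auto
    ultimately have "W T' = (Ln (\<sigma> * (Complex c (-T) - p)) - Ln (\<sigma> * (Complex c (-T') - p)))
        + W T + (Ln (\<sigma> * (Complex c T' - p)) - Ln (\<sigma> * (Complex c T - p)))"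
      by (rule has_integral_unique[rotated])
    then show ?thesis by (simp add: D_def)
  qed
  have "((\<lambda>T. W T - D T) \<longlongrightarrow> 2 * pi * \<i> * (\<sigma> / 2) - \<sigma> * pi * \<i>) at_top"
    unfolding W_def D_def using \<sigma>
    by (intro tendsto_diff tendsto_mult tendsto_const lim Ln_difference_tendsto) auto
  moreover have "((\<lambda>T. W T - D T) \<longlongrightarrow> W T - D T) at_top"
    by (rule tendsto_eventually, rule eventually_mono[OF eventually_ge_at_top[of T]], rule const)
  ultimately have "2 * pi * \<i> * (\<sigma> / 2) - \<sigma> * pi * \<i> = W T - D T"
    by (rule tendsto_unique[OF trivial_limit_at_top_linorder])
  then show ?thesis by (simp add: W_def D_def)
qed

lemma vertical_line_C1: "(\<lambda>t. Complex c t) piecewise_C1_differentiable_on S"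
proof -
  have "\<And>x. ((\<lambda>t. Complex c t) has_vector_derivative \<i>) (at x)"
    unfolding Complex_eq by (auto intro!: derivative_eq_intros)
  then have "(\<lambda>t. Complex c t) C1_differentiable_on S"
    by (auto simp: C1_differentiable_on_def intro!: exI[of _ "\<lambda>_. \<i>"])
  then show ?thesis by (rule C1_differentiable_imp_piecewise)
qed

lemma vector_derivative_vertical_line: "vector_derivative (\<lambda>t. Complex c t) (at t) = \<i>"
  by (rule vector_derivative_at) (unfold Complex_eq, auto intro!: derivative_eq_intros)

lemma mellin_barnes_contour_vertical_line: "mellin_barnes_contour (\<lambda>t. Complex c t)"
  unfolding mellin_barnes_contour_def
  by (auto simp: inj_def vertical_line_C1)

text \<open>The line lies in the half-plane \<open>\<sigma> * Re (z - p) > 0\<close>, away from the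
  cut of the chosen branch, so the logarithm gives the winding number of every truncation
  exactly.\<close>

lemma winding_number_vertical_line:
  fixes p c \<sigma> :: real
  assumes \<sigma>: "\<sigma> = 1 \<or> \<sigma> = -1" and pos: "\<sigma> * (c - p) > 0"
  shows "((\<lambda>T. winding_number (\<lambda>u. Complex c (T * (2 * u - 1))) p) \<longlongrightarrow> \<sigma> / 2) at_top"
proof -
  define D where "D = (\<lambda>T. Ln (\<sigma> * (Complex c T - p)) - Ln (\<sigma> * (Complex c (-T) - p)))"
  have p: "complex_of_real p \<notin> range (\<lambda>t. Complex c t)"
    using pos by (auto simp: complex_eq_iff)
  have eq: "winding_number (\<lambda>u. Complex c (T * (2 * u - 1))) p = D T / (2 * pi * \<i>)" if T: "T > 0" for T
  proof -
    let ?g = "\<lambda>u. Complex c (T * (2 * u - 1))"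
    have v: "valid_path ?g"
      using valid_path_symmetric[OF vertical_line_C1 T] .
    have "\<sigma> * (z - p) \<notin> \<real>\<^sub>\<le>\<^sub>0" if "z \<in> path_image ?g" for z :: complex
      using that pos by (auto simp: path_image_def complex_nonpos_Reals_iff)
    then have "((\<lambda>z. 1 / (z - p)) has_contour_integral D T) ?g"
      using has_contour_integral_inverse_Ln[OF v, of \<sigma> p] \<sigma>
      by (auto simp: D_def pathfinish_def pathstart_def)
    moreover have "p \<notin> path_image ?g" using p by (auto simp: path_image_def)
    ultimately show ?thesis
      using has_contour_integral_winding_number[OF v, of p]
      by (auto dest: has_contour_integral_unique)
  qed
  have "((\<lambda>T. D T / (2 * pi * \<i>)) \<longlongrightarrow> \<sigma> * pi * \<i> / (2 * pi * \<i>)) at_top"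
    unfolding D_def by (intro tendsto_divide tendsto_const Ln_difference_tendsto \<sigma>) auto
  then have "((\<lambda>T. D T / (2 * pi * \<i>)) \<longlongrightarrow> \<sigma> / 2) at_top" by simp
  then show ?thesis
    by (rule Lim_transform_eventually)
      (rule eventually_mono[OF eventually_gt_at_top[of 0]], simp add: eq)
qed

section \<open>Deformation of a separating contour to a vertical line\<close>

text \<open>Needed for the gauge integral, since the integral along a competing contour need not
  converge absolutely. Its definition on an unbounded domain already speaks of all boxes containing
  a large ball, and symmetric intervals are such boxes.\<close>

lemma has_integral_UNIV_imp_tendsto_symmetric:
  fixes h :: "real \<Rightarrow> complex"
  assumes h: "(h has_integral I) UNIV"
  shows "((\<lambda>T. integral {-T..T} h) \<longlongrightarrow> I) at_top"
proof (rule tendstoI)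
  fix e :: real assume "e > 0"
  have nc: "\<not> (\<exists>a b. (UNIV::real set) = cbox a b)"
    by (metis bounded_cbox not_bounded_UNIV)
  from \<open>e > 0\<close> obtain B where B: "B > 0" "\<And>a b. ball 0 B \<subseteq> cbox a b \<Longrightarrow>
      \<exists>z. (h has_integral z) (cbox a b) \<and> norm (z - I) < e"
    using has_integral_altD[OF h nc \<open>e > 0\<close>] by (simp only: UNIV_I if_True) blast
  show "\<forall>\<^sub>F T in at_top. dist (integral {-T..T} h) I < e"
    using eventually_ge_at_top[of B]
  proof eventually_elim
    case (elim T)
    have "ball 0 B \<subseteq> cbox (-T) T" using elim by (auto simp: dist_norm)
    from B(2)[OF this] show ?case by (auto simp: dist_norm integral_unique)
  qed
qed

lemma closed_segment_horizontal:
  assumes "s \<in> closed_segment (Complex a y) (Complex b y)"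
  shows "Re s \<in> {min a b..max a b}" "Im s = y"
proof -
  obtain u where u: "0 \<le> u" "u \<le> 1" and s: "s = (1 - u) *\<^sub>R Complex a y + u *\<^sub>R Complex b y"
    using assms unfolding closed_segment_def by blast
  have "Re s \<in> closed_segment a b"
    using u s by (auto simp: closed_segment_def)
  then show "Re s \<in> {min a b..max a b}"
    by (auto simp: closed_segment_eq_real_ivl split: if_splits)
  show "Im s = y" unfolding s by (simp add: algebra_simps)
qed

text \<open>The truncated contour \<open>P\<close>, followed by the upper edge, the line
  \<open>Re s = d\<close> downwards and the lower edge, is a closed loop, possibly with
  self-intersections. Around each pole, \<open>P\<close> contributes a difference of logarithms, and
  the way back contributes its negative because the same branch is valid there. Cauchy's theorem
  then leaves only the two horizontal edges, each of length
  \<open>\<bar>c - d\<bar>\<close>.\<close>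

lemma integral_contour_deformation:
  fixes A B :: "complex set" and c d R T :: real
  assumes real: "A \<subseteq> \<real>" "B \<subseteq> \<real>" and cl: "closed (A \<union> B)"
    and left: "\<And>p. p \<in> A \<Longrightarrow> Re p < d" and right: "\<And>p. p \<in> B \<Longrightarrow> Re p > d"
    and holo: "f holomorphic_on - (A \<union> B)"
    and C1: "\<And>T. T > 0 \<Longrightarrow> L piecewise_C1_differentiable_on {-T..T}"
    and tail: "\<And>t. \<bar>t\<bar> \<ge> R \<Longrightarrow> L t = Complex c t"
    and LA: "\<And>p. p \<in> A \<Longrightarrow> left_of_contour L p" and LB: "\<And>p. p \<in> B \<Longrightarrow> right_of_contour L p"
    and T: "T > 0" "T \<ge> R"
    and bound: "\<And>s. \<lbrakk>s \<in> closed_segment (Complex c T) (Complex d T) \<union>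
        closed_segment (Complex c (-T)) (Complex d (-T))\<rbrakk> \<Longrightarrow> norm (f s) \<le> b"
  shows "norm (integral {-T..T} (\<lambda>t. f (L t) * vector_derivative L (at t)) -
    integral {-T..T} (\<lambda>t. f (Complex d t) * \<i>)) \<le> 2 * b * \<bar>c - d\<bar>"
proof -
  define S where "S = - (A \<union> B)"
  define P where "P = (\<lambda>u. L (T * (2 * u - 1)))"
  define V where "V = (\<lambda>u. Complex d (T * (2 * u - 1)))"
  define hT where "hT = linepath (Complex c T) (Complex d T)"
  define hB where "hB = linepath (Complex d (-T)) (Complex c (-T))"
  define bk where "bk = hT +++ reversepath V +++ hB"
  have S: "open S" unfolding S_def by (rule open_Compl[OF cl])
  have vP: "valid_path P" unfolding P_def by (rule valid_path_symmetric[OF C1 T(1)]) (fact T)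
  have vV: "valid_path V" unfolding V_def by (rule valid_path_symmetric[OF vertical_line_C1 T(1)])
  have ends: "pathstart P = Complex c (-T)" "pathfinish P = Complex c T"
    "pathstart V = Complex d (-T)" "pathfinish V = Complex d T"
    using tail[of T] tail[of "-T"] T by (auto simp: P_def V_def pathstart_def pathfinish_def)
  have vback: "valid_path bk"
    using vV ends by (auto simp: bk_def hT_def hB_def intro!: valid_path_join)
  have eback: "pathstart bk = Complex c T" "pathfinish bk = Complex c (-T)"
    by (simp_all add: bk_def hT_def hB_def)
  have iback: "path_image bk = path_image hT \<union> path_image V \<union> path_image hB"
    using ends by (simp add: bk_def hT_def hB_def path_image_join Un_assoc)
  \<comment> \<open>The edges have height \<open>\<plusminus>T\<close>, nonzero, so the way back
    meets the real axis only at \<open>d\<close>.\<close>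
  have bk_real: "Re z = d" if "z \<in> path_image bk" "z \<in> \<real>" for z
  proof -
    have "Im z = 0" using that by (simp add: complex_is_Real_iff)
    then have "z \<notin> path_image hT" "z \<notin> path_image hB"
      using closed_segment_horizontal(2)[of z _ T] closed_segment_horizontal(2)[of z _ "-T"] T by (auto simp: hT_def hB_def)
    then have "z \<in> path_image V" using that iback by auto
    then show ?thesis by (auto simp: V_def path_image_def)
  qed
  have backS: "path_image bk \<subseteq> S"
    using bk_real real left right unfolding S_def by force
  have PS: "path_image P \<subseteq> S"
    using LA LB unfolding S_def P_def path_image_def left_of_contour_def right_of_contour_def by auto
  have loop: "pathfinish (P +++ bk) = pathstart (P +++ bk)"
    by (simp add: ends eback)
  have vloop: "valid_path (P +++ bk)"
    using vP vback by (simp add: valid_path_join ends eback)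
  have loopS: "path_image (P +++ bk) \<subseteq> S"
    using backS PS by (simp add: path_image_join ends eback)
  have wn: "winding_number (P +++ bk) w = 0" if w: "w \<notin> S" for w
  proof -
    define p where "p = Re w"
    have wp: "w = of_real p" using w real unfolding S_def p_def by (auto simp: of_real_Re)
    \<comment> \<open>The sign encodes the side of the pole: the cut of
      \<open>Ln (\<sigma> * (z - p))\<close> points away from \<open>d\<close>, and
      \<open>\<sigma> / 2\<close> is the limiting winding number prescribed for that side.\<close>
    obtain \<sigma> :: real where \<sigma>: "\<sigma> = 1 \<or> \<sigma> = -1" "\<sigma> * (d - p) > 0" "w \<notin> range L"
      "((\<lambda>T. winding_number (\<lambda>u. L (T * (2 * u - 1))) p) \<longlongrightarrow> \<sigma> / 2) at_top"
    proof (cases "w \<in> A")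
      case True
      with LA[OF True] left[OF True] that[of 1] show ?thesis
        by (auto simp: left_of_contour_def wp)
    next
      case False
      then have "w \<in> B" using w by (auto simp: S_def)
      with LB[of w] right[of w] that[of "-1"] show ?thesis
        by (auto simp: right_of_contour_def wp)
    qed
    have "2 * pi * \<i> * winding_number P p = Ln (\<sigma> * (Complex c T - p)) - Ln (\<sigma> * (Complex c (-T) - p))"
      unfolding P_def using \<sigma> wp T by (intro winding_number_truncated_contour[OF \<sigma>(1) C1 tail]) auto
    moreover have "2 * pi * \<i> * winding_number bk p = Ln (\<sigma> * (Complex c (-T) - p)) - Ln (\<sigma> * (Complex c T - p))"
    proof -
      have "of_real \<sigma> * (z - p) \<notin> \<real>\<^sub>\<le>\<^sub>0" if z: "z \<in> path_image bk" for z
      proof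
        assume *: "of_real \<sigma> * (z - p) \<in> \<real>\<^sub>\<le>\<^sub>0"
        then have "z \<in> \<real>" using \<sigma>(1) by (auto simp: complex_nonpos_Reals_iff complex_is_Real_iff)
        with bk_real[OF z] * \<sigma> show False by (auto simp: complex_nonpos_Reals_iff)
      qed
      then have "((\<lambda>z. 1 / (z - p)) has_contour_integral
          Ln (\<sigma> * (Complex c (-T) - p)) - Ln (\<sigma> * (Complex c T - p))) bk"
        using has_contour_integral_inverse_Ln[OF vback, of \<sigma> p] \<sigma>(1) by (auto simp: eback)
      moreover have "of_real p \<notin> path_image bk" using backS w wp by auto
      ultimately show ?thesis
        using has_contour_integral_winding_number[OF vback, of p]
        by (auto dest: has_contour_integral_unique)
    qed
    moreover have "winding_number (P +++ bk) w = winding_number P w + winding_number bk w"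
      using vP vback PS backS w
      by (intro winding_number_join valid_path_imp_path) (auto simp: ends eback)
    ultimately have "2 * pi * \<i> * winding_number (P +++ bk) w = 0"
      by (simp add: wp distrib_left)
    then show ?thesis by simp
  qed
  have holoS: "f holomorphic_on S" using holo by (simp add: S_def)
  have zero: "(f has_contour_integral 0) (P +++ bk)"
    by (rule Cauchy_theorem_global[OF S holoS vloop loop loopS wn])
  have subs: "path_image hT \<subseteq> S" "path_image V \<subseteq> S" "path_image hB \<subseteq> S"
    using backS iback by auto
  have fP: "f contour_integrable_on P" and fV: "f contour_integrable_on V"
    and ft: "f contour_integrable_on hT" and fb: "f contour_integrable_on hB"
    using subs PS vP vV by (auto intro!: contour_integrable_holomorphic_simple[OF holoS S] simp: hT_def hB_def)
  have "contour_integral (P +++ bk) f = contour_integral P f + (contour_integral hT f +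
      (- contour_integral V f + contour_integral hB f))"
    unfolding bk_def using fP fV ft fb vP vV
    by (simp add: contour_integral_reversepath contour_integrable_reversepath ends hT_def hB_def)
  then have diff: "contour_integral P f - contour_integral V f = - contour_integral hT f - contour_integral hB f"
    using contour_integral_unique[OF zero] by (simp add: algebra_simps add_eq_0_iff2)
  have b0: "b \<ge> 0" using bound[of "Complex c T"] norm_ge_zero[of "f (Complex c T)"] by (smt (verit) UnI1 ends_in_segment(1))
  have nrm: "cmod (Complex d y - Complex c y) = \<bar>c - d\<bar>" for y
    by (simp add: cmod_def abs_minus_commute)
  then have nrm': "cmod (Complex c y - Complex d y) = \<bar>c - d\<bar>" for y
    by (metis norm_minus_commute)
  have "norm (contour_integral hT f) \<le> b * \<bar>c - d\<bar>"
    using contour_integral_bound_linepath[of f "Complex c T" "Complex d T" b] ft b0 bound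
    by (simp add: hT_def nrm)
  moreover have "norm (contour_integral hB f) \<le> b * \<bar>c - d\<bar>"
    using contour_integral_bound_linepath[of f "Complex d (-T)" "Complex c (-T)" b] fb b0 bound
    by (simp add: hB_def closed_segment_commute nrm nrm')
  moreover have "contour_integral P f = integral {-T..T} (\<lambda>t. f (L t) * vector_derivative L (at t))"
    using has_contour_integral_integral[OF fP] has_contour_integral_symmetric_iff[OF T(1) C1[OF T(1)], of f]
    by (simp add: P_def integral_unique)
  moreover have "contour_integral V f = integral {-T..T} (\<lambda>t. f (Complex d t) * \<i>)"
    using has_contour_integral_integral[OF fV, unfolded V_def
        has_contour_integral_symmetric_iff[OF T(1) vertical_line_C1]]
    unfolding V_def vector_derivative_vertical_line by (rule integral_unique[symmetric])
  moreover have "norm (- contour_integral hT f - contour_integral hB f) \<le>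
      norm (contour_integral hT f) + norm (contour_integral hB f)"
    by (metis norm_minus_cancel norm_triangle_ineq4)
  ultimately show ?thesis using diff by simp
qed

text \<open>The decay is required on every vertical strip because the abscissa \<open>c\<close> of
  the tails of \<open>L\<close> is arbitrary. At height \<open>T\<close> the horizontal edges
  contribute at most \<open>2 * b T * \<bar>c - d\<bar>\<close>, which vanishes in the
  limit.\<close>

lemma mellin_barnes_integral_unique:
  fixes A B :: "complex set" and d :: real
  assumes real: "A \<subseteq> \<real>" "B \<subseteq> \<real>" and cl: "closed (A \<union> B)"
    and left: "\<And>p. p \<in> A \<Longrightarrow> Re p < d" and right: "\<And>p. p \<in> B \<Longrightarrow> Re p > d"
    and holo: "f holomorphic_on - (A \<union> B)"
    and decay: "\<And>x y. \<exists>b. (b \<longlongrightarrow> 0) at_top \<and>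
        (\<forall>s. Re s \<in> {x..y} \<and> \<bar>Im s\<bar> \<ge> 1 \<longrightarrow> norm (f s) \<le> b \<bar>Im s\<bar>)"
    and line: "((\<lambda>t. f (Complex d t) * \<i>) has_integral J) UNIV"
    and L: "mellin_barnes_contour L"
    and LA: "\<And>p. p \<in> A \<Longrightarrow> left_of_contour L p" and LB: "\<And>p. p \<in> B \<Longrightarrow> right_of_contour L p"
    and I: "((\<lambda>t. f (L t) * vector_derivative L (at t)) has_integral I) UNIV"
  shows "I = J"
proof -
  from L obtain c R where C1: "\<And>T. T > 0 \<Longrightarrow> L piecewise_C1_differentiable_on {-T..T}"
    and tail: "\<And>t. \<bar>t\<bar> \<ge> R \<Longrightarrow> L t = Complex c t"
    unfolding mellin_barnes_contour_def by auto
  obtain b where b: "(b \<longlongrightarrow> 0) at_top"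
    "\<And>s. Re s \<in> {min c d..max c d} \<Longrightarrow> \<bar>Im s\<bar> \<ge> 1 \<Longrightarrow> norm (f s) \<le> b \<bar>Im s\<bar>"
    using decay by blast
  have "((\<lambda>T. integral {-T..T} (\<lambda>t. f (L t) * vector_derivative L (at t)) -
    integral {-T..T} (\<lambda>t. f (Complex d t) * \<i>)) \<longlongrightarrow> 0) at_top"
  proof (rule Lim_null_comparison)
    show "((\<lambda>T. 2 * b T * \<bar>c - d\<bar>) \<longlongrightarrow> 0) at_top"
      by (rule tendsto_eq_intros b refl | simp)+
    show "\<forall>\<^sub>F T in at_top. norm (integral {-T..T} (\<lambda>t. f (L t) * vector_derivative L (at t)) -
        integral {-T..T} (\<lambda>t. f (Complex d t) * \<i>)) \<le> 2 * b T * \<bar>c - d\<bar>"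
      using eventually_ge_at_top[of "max 1 R"]
    proof eventually_elim
      case (elim T)
      have "norm (f s) \<le> b T" if "s \<in> closed_segment (Complex c T) (Complex d T) \<union>
        closed_segment (Complex c (-T)) (Complex d (-T))" for s
        using that closed_segment_horizontal[of s c T d] closed_segment_horizontal[of s c "-T" d] b(2)[of s] elim by auto
      then show ?case
        using elim by (intro integral_contour_deformation[OF real cl left right holo C1 tail LA LB]) auto
    qed
  qed
  moreover have "((\<lambda>T. integral {-T..T} (\<lambda>t. f (L t) * vector_derivative L (at t)) -
    integral {-T..T} (\<lambda>t. f (Complex d t) * \<i>)) \<longlongrightarrow> I - J) at_top"
    by (intro tendsto_diff has_integral_UNIV_imp_tendsto_symmetric I line)
  ultimately have "0 = I - J"
    by (rule tendsto_unique[OF trivial_limit_at_top_linorder])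
  then show ?thesis by simp
qed

section \<open>The Mellin-Barnes representation of the logarithm\<close>

lemma cosh_pi_ge: "1 + t\<^sup>2 \<le> cosh (pi * t)" for t :: real
proof -
  \<comment> \<open>Adding \<open>1 + x + x^2 / 2 \<le> exp x\<close> and
    \<open>1 - x \<le> exp (- x)\<close> cancels the linear terms. The loss of the factor
    \<open>1/4\<close> is made up by \<open>pi^2 \<ge> 4\<close>.\<close>
  have *: "1 + x\<^sup>2 / 4 \<le> cosh x" if "x \<ge> 0" for x :: real
    using exp_lower_Taylor_quadratic[OF that] exp_ge_add_one_self[of "-x"]
    by (simp add: cosh_def field_simps)
  have "4 \<le> pi\<^sup>2" using power_mono[of 2 pi 2] pi_ge_two by simp
  then have "4 * t\<^sup>2 \<le> pi\<^sup>2 * t\<^sup>2" by (intro mult_right_mono) auto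
  then have "1 + t\<^sup>2 \<le> 1 + (pi * \<bar>t\<bar>)\<^sup>2 / 4" by (simp add: power_mult_distrib)
  also have "\<dots> \<le> cosh (pi * \<bar>t\<bar>)" by (rule *) simp
  also have "cosh (pi * \<bar>t\<bar>) = cosh (pi * t)" by (simp add: abs_if)
  finally show ?thesis .
qed

lemma integrable_sech: "integrable lborel (\<lambda>t::real. 1 / cosh (pi * t))"
proof (rule Bochner_Integration.integrable_bound)
  show "integrable lborel (\<lambda>t::real. inverse (1 + t\<^sup>2))"
    using integrable_inverse_1_plus_square by (simp add: set_integrable_def)
  show "(\<lambda>t::real. 1 / cosh (pi * t)) \<in> borel_measurable lborel"
    by (simp add: cosh_def)
  have "1 / cosh (pi * t) \<le> inverse (1 + t\<^sup>2)" for t :: real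
    using cosh_pi_ge[of t] le_imp_inverse_le[OF cosh_pi_ge[of t]]
    by (simp add: inverse_eq_divide add_pos_nonneg)
  then show "AE t in lborel. norm (1 / cosh (pi * t)) \<le> norm (inverse (1 + (t::real)\<^sup>2))"
    by simp
qed

text \<open>The square of the right-hand side is \<open>sinh^2 (Re z) + cos^2 (Im z)\<close>. The
  bound is uniform in \<open>Im z\<close>, as the vertical sides of the rectangle require.\<close>

lemma norm_cosh_ge: "\<bar>sinh (Re z)\<bar> \<le> norm (cosh z)" for z :: complex
proof -
  have "(sinh (Re z))\<^sup>2 \<le> (norm (cosh z))\<^sup>2"
    unfolding cosh_conv_cos norm_cos_squared
    by (simp add: sinh_def exp_minus power_divide)
  then show ?thesis by (metis abs_ge_self abs_le_square_iff abs_norm_cancel order_trans power2_abs)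
qed

lemma horizontal_C1: "(\<lambda>t. of_real t + w :: complex) piecewise_C1_differentiable_on S"
proof -
  have "\<And>x. ((\<lambda>t. of_real t + w :: complex) has_vector_derivative 1) (at x)"
    by (auto intro!: derivative_eq_intros)
  then have "(\<lambda>t. of_real t + w :: complex) C1_differentiable_on S"
    by (auto simp: C1_differentiable_on_def intro!: exI[of _ "\<lambda>_. 1"])
  then show ?thesis by (rule C1_differentiable_imp_piecewise)
qed

lemma contour_integral_horizontal:
  assumes T: "T > 0" and f: "f contour_integrable_on linepath (- of_real T + w) (of_real T + w)"
  shows "contour_integral (linepath (- of_real T + w) (of_real T + w)) f =
    integral {-T..T} (\<lambda>t. f (of_real t + w))"
proof -
  have "vector_derivative (\<lambda>t. of_real t + w :: complex) (at t) = 1" for t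
    by (rule vector_derivative_at) (auto intro!: derivative_eq_intros)
  moreover have "linepath (- of_real T + w) (of_real T + w) = (\<lambda>u. of_real (T * (2 * u - 1)) + w)"
    by (auto simp: linepath_def fun_eq_iff scaleR_conv_of_real algebra_simps)
  ultimately show ?thesis
    using has_contour_integral_integral[OF f] has_contour_integral_symmetric_iff[OF T horizontal_C1, of f _ w]
    by (simp add: integral_unique)
qed

text \<open>Raising \<open>z\<close> by \<open>\<i>\<close> changes the sign of
  \<open>cosh (pi z)\<close> and multiplies \<open>exp (\<i> v z)\<close> by
  \<open>exp (-v)\<close>. The top edge of the rectangle, traversed backwards, therefore reproduces
  the bottom integral times \<open>exp (-v)\<close>, whence the factor \<open>1 + exp (-v)\<close>.
  The pole at \<open>\<i> / 2\<close> yields \<open>2 exp (- v / 2)\<close>, and each of the two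
  vertical sides accounts for half of the error.\<close>

lemma integral_sech_truncated:
  fixes v T :: real
  assumes T: "T > 0"
  shows "norm ((1 + exp (-v)) * integral {-T..T} (\<lambda>t. exp (\<i> * v * t) / of_real (cosh (pi * t))) - 2 * exp (- v / 2))
     \<le> 2 * (exp \<bar>v\<bar> / sinh (pi * T))"
proof -
  define h where "h = (\<lambda>z::complex. exp (\<i> * v * z) / cosh (pi * z))"
  \<comment> \<open>The strip ends at the neighbouring zeros \<open>- \<i> / 2\<close> and
    \<open>3 \<i> / 2\<close> of \<open>cosh (pi z)\<close>, so that \<open>\<i> / 2\<close> is the
    only zero inside.\<close>
  define S where "S = {z. -1/2 < Im z} \<inter> {z. Im z < 3/2}"
  define z0 where "z0 = \<i> / 2"
  have S: "open S" "connected S" "convex S"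
    unfolding S_def
    by (intro open_Int open_halfspace_Im_lt open_halfspace_Im_gt convex_connected
        convex_Int convex_halfspace_Im_lt convex_halfspace_Im_gt)+
  have z0S: "z0 \<in> S" by (simp add: S_def z0_def)
  have zeros: "cosh (of_real pi * z) \<noteq> 0" if "z \<in> S - {z0}" for z
  proof
    assume "cosh (of_real pi * z) = 0"
    then have "cos (\<i> * (of_real pi * z)) = 0" by (simp add: cosh_conv_cos)
    then obtain n :: int where n: "\<i> * (of_real pi * z) = of_real (real_of_int n * pi) + of_real pi / 2"
      unfolding cos_eq_0 by blast
    have "pi * (- Im z) = pi * (n + 1/2)"
      using arg_cong[OF n, of Re] by (simp add: algebra_simps)
    then have "- Im z = n + 1/2" by (subst (asm) mult_cancel_left) simp
    have "Re z = 0"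
      using arg_cong[OF n, of Im] by simp
    have "real_of_int n < 0" "real_of_int n > -2"
      using that \<open>- Im z = n + 1/2\<close> unfolding S_def by auto
    then have "n = -1" by linarith
    with \<open>Re z = 0\<close> \<open>- Im z = n + 1/2\<close> that show False
      by (auto simp: z0_def complex_eq_iff)
  qed
  have cosh_holo: "(\<lambda>z. cosh (of_real pi * z)) holomorphic_on A" for A
    unfolding cosh_conv_cos by (intro holomorphic_intros)
  have holo: "h holomorphic_on S - {z0}"
    unfolding h_def using zeros by (auto intro!: holomorphic_intros cosh_holo)
  have cosh_z0: "cosh (of_real pi * z0) = 0" "sinh (of_real pi * z0) = \<i>"
  proof -
    have "\<i> * (of_real pi * z0) = of_real (- (pi / 2))" by (simp add: z0_def complex_eq_iff)
    then show "cosh (of_real pi * z0) = 0" "sinh (of_real pi * z0) = \<i>"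
      unfolding cosh_conv_cos sinh_conv_sin by (simp_all only: cos_of_real sin_of_real) simp_all
  qed
  have res: "residue h z0 = exp (\<i> * v * z0) / (of_real pi * \<i>)"
    unfolding h_def
  proof (rule residue_simple_pole_deriv[OF _ _ S(1,2) z0S])
    show "((\<lambda>z. cosh (of_real pi * z)) has_field_derivative of_real pi * \<i>) (at z0)"
      by (auto intro!: derivative_eq_intros simp: cosh_z0)
  qed (auto intro!: holomorphic_intros cosh_holo simp: cosh_z0)
  define a1 where "a1 = Complex (-T) 0"
  define a3 where "a3 = Complex T 1"
  let ?g = "rectpath a1 a3"
  have gS: "path_image ?g \<subseteq> S - {z0}"
    using T by (subst path_image_rectpath) (auto simp: a1_def a3_def S_def z0_def)
  have "contour_integral ?g h = 2 * pi * \<i> * (\<Sum>p\<in>{z0}. winding_number ?g p * residue h p)"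
  proof (rule Residue_theorem[OF S(1,2) _ holo _ _ gS])
    show "\<forall>z. z \<notin> S \<longrightarrow> winding_number ?g z = 0"
      using gS by (intro allI impI winding_number_zero_outside[OF _ S(3)]) auto
  qed auto
  moreover have "winding_number ?g z0 = 1"
    using T by (intro winding_number_rectpath) (auto simp: in_box_complex_iff a1_def a3_def z0_def)
  ultimately have *: "contour_integral ?g h = 2 * pi * \<i> * residue h z0" by simp
  have int: "contour_integral ?g h = 2 * exp (- v / 2)"
  proof -
    have "\<i> * v * z0 = of_real (- v / 2)" by (simp add: z0_def complex_eq_iff)
    then have e: "exp (\<i> * v * z0) = of_real (exp (- v / 2))" by (simp only: exp_of_real)
    have "of_real (2 * pi) * \<i> * (of_real x / (of_real pi * \<i>)) = of_real (2 * x)" for x :: real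
      by (simp add: complex_eq_iff Re_divide Im_divide power2_eq_square)
    then show ?thesis by (simp only: * res e)
  qed
  let ?b = "linepath (Complex (-T) 0) (Complex T 0)" and ?r = "linepath (Complex T 0) (Complex T 1)"
  let ?t = "linepath (Complex T 1) (Complex (-T) 1)" and ?l = "linepath (Complex (-T) 1) (Complex (-T) 0)"
  have g: "?g = ?b +++ ?r +++ ?t +++ ?l"
    by (simp add: rectpath_def Let_def a1_def a3_def)
  have subs: "path_image ?b \<subseteq> S - {z0}" "path_image ?r \<subseteq> S - {z0}"
    "path_image ?t \<subseteq> S - {z0}" "path_image ?l \<subseteq> S - {z0}"
    using gS unfolding g by (auto simp: path_image_join)
  have opn: "open (S - {z0})" using S by auto
  have intb: "h contour_integrable_on ?b" "h contour_integrable_on ?r"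
    "h contour_integrable_on ?t" "h contour_integrable_on ?l"
    using subs by (auto intro!: contour_integrable_holomorphic_simple[OF holo opn])
  have sum: "contour_integral ?g h = contour_integral ?b h + (contour_integral ?r h +
      (contour_integral ?t h + contour_integral ?l h))"
    unfolding g using intb by simp
  have cosh_real: "cosh (of_real pi * complex_of_real t) = of_real (cosh (pi * t))" for t
    by (simp add: cosh_field_def exp_of_real flip: of_real_mult of_real_minus)
  define I where "I = integral {-T..T} (\<lambda>t. exp (\<i> * v * t) / of_real (cosh (pi * t)) :: complex)"
  have cplx: "Complex (-T) 0 = - of_real T + 0" "Complex T 0 = of_real T + 0"
    "Complex (-T) 1 = - of_real T + \<i>" "Complex T 1 = of_real T + \<i>"
    by (simp_all add: complex_eq_iff)
  have B: "contour_integral ?b h = I"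
    using intb(1) contour_integral_horizontal[OF T, of h 0] unfolding cplx by (simp add: I_def h_def cosh_real)
  have rev: "?t = reversepath (linepath (Complex (-T) 1) (Complex T 1))" by simp
  have "h contour_integrable_on (linepath (Complex (-T) 1) (Complex T 1))"
    using intb(3) unfolding rev by (subst (asm) contour_integrable_reversepath_eq) auto
  then have "contour_integral ?t h = - integral {-T..T} (\<lambda>t. h (of_real t + \<i>))"
    unfolding rev using contour_integral_horizontal[OF T, of h \<i>]
    by (subst contour_integral_reversepath) (simp_all only: cplx valid_path_linepath)
  also have "(\<lambda>t. h (complex_of_real t + \<i>)) = (\<lambda>t. - (exp (-v) * (exp (\<i> * v * t) / of_real (cosh (pi * t)))))"
  proof
    fix t
    have "cosh (of_real pi * (complex_of_real t + \<i>)) = - cosh (of_real pi * of_real t)"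
      by (simp add: cosh_conv_cos distrib_left cos_add cos_diff algebra_simps)
    moreover have "exp (\<i> * v * (complex_of_real t + \<i>)) = exp (-v) * exp (\<i> * v * t)"
    proof -
      have "\<i> * v * (complex_of_real t + \<i>) = of_real (-v) + \<i> * v * t"
        by (simp add: algebra_simps)
      then show ?thesis by (simp only: exp_add exp_of_real)
    qed
    ultimately show "h (complex_of_real t + \<i>) = - (exp (-v) * (exp (\<i> * v * t) / of_real (cosh (pi * t))))"
      by (simp add: h_def cosh_real)
  qed
  finally have Tp: "contour_integral ?t h = exp (-v) * I" by (simp add: I_def del: times_divide_eq_right)
  have bnd: "norm (h s) \<le> exp \<bar>v\<bar> / sinh (pi * T)" if s: "\<bar>Re s\<bar> = T" "Im s \<in> {0..1}" for s
  proof -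
    have "\<bar>v * Im s\<bar> \<le> \<bar>v\<bar> * 1" unfolding abs_mult using s by (intro mult_left_mono) auto
    then have "exp (- (v * Im s)) \<le> exp \<bar>v\<bar>" by simp
    moreover have "sinh (pi * T) \<le> norm (cosh (of_real pi * s))"
    proof -
      have "\<bar>sinh (pi * Re s)\<bar> = sinh (pi * T)"
      proof -
        have "Re s = T \<or> Re s = - T" using s(1) by linarith
        moreover have "sinh (pi * T) > 0" using T by simp
        ultimately show ?thesis by auto
      qed
      then show ?thesis using norm_cosh_ge[of "of_real pi * s"] by simp
    qed
    moreover have "sinh (pi * T) > 0" using T by simp
    ultimately show ?thesis
      unfolding h_def norm_divide by (intro frac_le) (auto simp: mult.assoc)
  qed
  have pos: "0 \<le> exp \<bar>v\<bar> / sinh (pi * T)" using T by simp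
  have n1: "cmod (Complex x 1 - Complex x 0) = 1" "cmod (Complex x 0 - Complex x 1) = 1" for x
    by (simp_all add: cmod_def)
  have R: "norm (contour_integral ?r h) \<le> exp \<bar>v\<bar> / sinh (pi * T)"
    using contour_integral_bound_linepath[OF intb(2) pos] bnd T
    by (auto simp: closed_segment_same_Re closed_segment_eq_real_ivl n1)
  have Lf: "norm (contour_integral ?l h) \<le> exp \<bar>v\<bar> / sinh (pi * T)"
    using contour_integral_bound_linepath[OF intb(4) pos] bnd T
    by (auto simp: closed_segment_same_Re closed_segment_eq_real_ivl n1)
  have "(1 + exp (-v)) * I - 2 * exp (- v / 2) = - contour_integral ?r h - contour_integral ?l h"
    using sum int unfolding B Tp by (simp add: algebra_simps)
  moreover have "norm (- contour_integral ?r h - contour_integral ?l h) \<le>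
      norm (contour_integral ?r h) + norm (contour_integral ?l h)"
    by (metis norm_minus_cancel norm_triangle_ineq4)
  ultimately show ?thesis using R Lf by (simp add: I_def)
qed

lemma inverse_sinh_tendsto_0: "((\<lambda>T::real. C / sinh (pi * T)) \<longlongrightarrow> 0) at_top"
proof -
  have "((\<lambda>T::real. 1 / sinh (pi * T)) \<longlongrightarrow> 0) at_top"
    unfolding sinh_field_def by real_asymp
  from tendsto_mult[OF tendsto_const[of C] this] show ?thesis by simp
qed

text \<open>In the limit the vertical sides disappear, and
  \<open>2 exp (- v / 2) / (1 + exp (-v))\<close> is \<open>1 / cosh (v / 2)\<close>.\<close>

lemma sech_fourier:
  fixes v :: real
  shows "(\<integral>t. exp (\<i> * v * t) / of_real (cosh (pi * t)) \<partial>lborel) = of_real (1 / cosh (v / 2))"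
proof -
  define g where "g = (\<lambda>t::real. exp (\<i> * v * t) / of_real (cosh (pi * t)) :: complex)"
  define c where "c = complex_of_real (1 + exp (-v))"
  have g: "integrable lborel g"
  proof (rule Bochner_Integration.integrable_bound[OF integrable_sech])
    show "g \<in> borel_measurable lborel" unfolding g_def cosh_field_def by measurable
  qed (simp add: g_def norm_divide)
  have "((\<lambda>T. c * integral {-T..T} g - 2 * exp (- v / 2)) \<longlongrightarrow> c * (\<integral>t. g t \<partial>lborel) - 2 * exp (- v / 2)) at_top"
    by (intro tendsto_intros has_integral_UNIV_imp_tendsto_symmetric has_integral_integral_lborel g)
  moreover have "((\<lambda>T. c * integral {-T..T} g - 2 * exp (- v / 2)) \<longlongrightarrow> 0) at_top"
  proof (rule Lim_null_comparison)
    show "((\<lambda>T. 2 * (exp \<bar>v\<bar> / sinh (pi * T))) \<longlongrightarrow> 0) at_top"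
      using tendsto_mult[OF tendsto_const[of 2] inverse_sinh_tendsto_0[of "exp \<bar>v\<bar>"]] by simp
    show "\<forall>\<^sub>F T in at_top. norm (c * integral {-T..T} g - 2 * exp (- v / 2)) \<le> 2 * (exp \<bar>v\<bar> / sinh (pi * T))"
      using eventually_gt_at_top[of 0]
    proof eventually_elim
      case (elim T)
      show ?case using integral_sech_truncated[OF elim, of v] by (simp add: c_def g_def)
    qed
  qed
  ultimately have "c * (\<integral>t. g t \<partial>lborel) - 2 * exp (- v / 2) = 0"
    by (rule tendsto_unique[OF trivial_limit_at_top_linorder])
  then have "c * (\<integral>t. g t \<partial>lborel) = of_real (2 * exp (- v / 2))" by simp
  moreover have "2 * exp (- v / 2) = (1 + exp (-v)) * (1 / cosh (v / 2))"
  proof -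
    have "exp (-v) = exp (- v / 2) * exp (- v / 2)" "exp (v / 2) * exp (- v / 2) = 1"
      by (simp_all flip: exp_add)
    then have "1 + exp (-v) = 2 * exp (- v / 2) * cosh (v / 2)"
      by (simp add: cosh_field_def algebra_simps)
    then show ?thesis using cosh_real_pos[of "v / 2"] by simp
  qed
  ultimately have "c * (\<integral>t. g t \<partial>lborel) = c * of_real (1 / cosh (v / 2))"
    by (simp only: c_def of_real_mult)
  moreover have "c \<noteq> 0"
  proof -
    have "1 + exp (-v) > 0" by (simp add: add_pos_pos)
    then show ?thesis unfolding c_def of_real_eq_0_iff by linarith
  qed
  ultimately have "(\<integral>t. g t \<partial>lborel) = of_real (1 / cosh (v / 2))"
    using mult_cancel_left by blast
  then show ?thesis unfolding g_def .
qed

section \<open>From the Fourier transform to \<open>ln (1 + x)\<close>\<close>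

lemma Fubini_product_bound:
  fixes f :: "real \<Rightarrow> real \<Rightarrow> complex" and a b :: "real \<Rightarrow> real"
  assumes f: "(\<lambda>(x, y). f x y) \<in> borel_measurable (lborel \<Otimes>\<^sub>M lborel)"
    and a: "integrable lborel a" and b: "integrable lborel b"
    and le: "\<And>x y. norm (f x y) \<le> a x * b y"
  shows "(\<integral>y. (\<integral>x. f x y \<partial>lborel) \<partial>lborel) = (\<integral>x. (\<integral>y. f x y \<partial>lborel) \<partial>lborel)"
proof (rule lborel_pair.Fubini_integral)
  have [measurable]: "a \<in> borel_measurable lborel" "b \<in> borel_measurable lborel"
    using a b by auto
  have "integrable (lborel \<Otimes>\<^sub>M lborel) (\<lambda>(x, y). a x * b y)"
  proof (rule lborel_pair.Fubini_integrable)
    show "(\<lambda>(x, y). a x * b y) \<in> borel_measurable (lborel \<Otimes>\<^sub>M lborel)" by measurable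
    show "integrable lborel (\<lambda>x. \<integral>y. norm (case (x, y) of (x, y) \<Rightarrow> a x * b y) \<partial>lborel)"
      using a by (simp add: abs_mult)
    show "AE x in lborel. integrable lborel (\<lambda>y. case (x, y) of (x, y) \<Rightarrow> a x * b y)"
      using b by simp
  qed
  then show "integrable (lborel \<Otimes>\<^sub>M lborel) (\<lambda>(x, y). f x y)"
    by (rule Bochner_Integration.integrable_bound[OF _ f])
      (auto intro!: AE_I2 order_trans[OF le abs_ge_self])
qed

text \<open>Stated on the open interval for the sake of \<open>y powr w\<close> with
  \<open>Re w = 1/2\<close>, which is continuous at \<open>0\<close> but whose derivative is
  unbounded there.\<close>

lemma set_lebesgue_integral_Ioo_FTC:
  fixes F f :: "real \<Rightarrow> complex"
  assumes ab: "a \<le> b" and F: "continuous_on {a..b} F"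
    and deriv: "\<And>x. x \<in> {a<..<b} \<Longrightarrow> (F has_vector_derivative f x) (at x)"
    and f: "set_integrable lborel {a<..<b} f"
  shows "(LINT x:{a<..<b}|lborel. f x) = F b - F a"
proof -
  have "(f has_integral (F b - F a)) {a..b}"
    by (rule fundamental_theorem_of_calculus_interior[OF ab F deriv])
  then have "(f has_integral (F b - F a)) {a<..<b}"
    by (simp add: has_integral_Icc_iff_Ioo)
  then show ?thesis
    using set_borel_integral_eq_integral(2)[OF f] by (simp add: integral_unique)
qed

text \<open>The function is \<open>y powr (-1/2)\<close>, written as an exponential to match the
  modulus of \<open>exp ((w - 1) * ln y)\<close> for \<open>Re w = 1/2\<close>.\<close>

lemma set_integrable_inverse_sqrt:
  fixes x :: real
  assumes "x > 0"
  shows "set_integrable lborel {0<..<x} (\<lambda>y. exp (- ln y / 2))"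
proof -
  have "(\<lambda>y. y powr (-1/2)) integrable_on {0..x}"
    by (rule integrable_on_powr_from_0) (use assms in auto)
  then have "(\<lambda>y. y powr (-1/2)) absolutely_integrable_on {0..x}"
    by (rule nonnegative_absolutely_integrable_1) auto
  then have "(\<lambda>y. y powr (-1/2)) absolutely_integrable_on {0<..<x}"
    by (rule set_integrable_subset) auto
  then have "integrable lebesgue (\<lambda>y. indicator {0<..<x} y *\<^sub>R y powr (-1/2))"
    by (simp add: set_integrable_def)
  then have "integrable lborel (\<lambda>y. indicator {0<..<x} y *\<^sub>R y powr (-1/2))"
    by (subst (asm) integrable_completion) auto
  also have "(\<lambda>y. indicator {0<..<x} y *\<^sub>R y powr (-1/2)) = (\<lambda>y. indicator {0<..<x} y *\<^sub>R exp (- ln y / 2))"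
    by (auto simp: fun_eq_iff indicator_def powr_def)
  finally show ?thesis by (simp add: set_integrable_def)
qed

text \<open>Consider \<open>y^(w - 1) / cosh (pi t)\<close> with \<open>w = 1/2 + \<i> t\<close> and
  \<open>0 < y < x\<close>. Integrated over \<open>t\<close>, it is the Fourier transform at
  \<open>v = ln y\<close> times \<open>y^(-1/2)\<close>, that is \<open>2 / (1 + y)\<close>; a
  further integration over \<open>y\<close> gives \<open>2 ln (1 + x)\<close>. In the other order
  the integral over \<open>y\<close> gives \<open>x^w / w\<close>, which is where the second factor
  of the denominator comes from.\<close>

lemma ln_mellin_barnes:
  fixes x :: real
  assumes x: "x > 0"
  shows "complex_of_real (ln (1 + x)) =
    1 / 2 * (\<integral>t. exp ((1 / 2 + \<i> * t) * of_real (ln x)) / (of_real (cosh (pi * t)) * (1 / 2 + \<i> * t)) \<partial>lborel)"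
proof -
  define f where "f = (\<lambda>y t. indicator {0<..<x} y *\<^sub>R
    (exp ((- 1 / 2 + \<i> * complex_of_real t) * of_real (ln y)) / of_real (cosh (pi * t))))"
  have norm_f: "norm (f y t) = indicator {0<..<x} y *\<^sub>R exp (- ln y / 2) * (1 / cosh (pi * t))" for y t
    by (simp add: f_def norm_divide indicator_def)
  have swap: "(\<integral>t. (\<integral>y. f y t \<partial>lborel) \<partial>lborel) = (\<integral>y. (\<integral>t. f y t \<partial>lborel) \<partial>lborel)"
  proof (rule Fubini_product_bound)
    show "(\<lambda>(y, t). f y t) \<in> borel_measurable (lborel \<Otimes>\<^sub>M lborel)"
      unfolding f_def cosh_field_def by measurable
    show "integrable lborel (\<lambda>y. indicator {0<..<x} y *\<^sub>R exp (- ln y / 2))"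
      using set_integrable_inverse_sqrt[OF x] by (simp add: set_integrable_def)
    show "integrable lborel (\<lambda>t::real. 1 / cosh (pi * t))" by (rule integrable_sech)
  qed (simp add: norm_f)
  have "(\<integral>t. f y t \<partial>lborel) = indicator {0<..<x} y *\<^sub>R of_real (2 / (1 + y))" for y
  proof (cases "y \<in> {0<..<x}")
    case True
    then have y: "y > 0" by simp
    have "exp ((- 1 / 2 + \<i> * complex_of_real t) * of_real (ln y)) = of_real (exp (- ln y / 2)) * exp (\<i> * of_real (ln y) * t)" for t
    proof -
      have "(- 1 / 2 + \<i> * complex_of_real t) * of_real (ln y) = of_real (- ln y / 2) + \<i> * of_real (ln y) * t"
        by (simp add: algebra_simps)
      then show ?thesis by (simp only: exp_add exp_of_real)
    qed
    then have "f y = (\<lambda>t. exp (- ln y / 2) * (exp (\<i> * of_real (ln y) * t) / of_real (cosh (pi * t))))"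
      using True by (simp add: f_def fun_eq_iff)
    then have "(\<integral>t. f y t \<partial>lborel) = of_real (exp (- ln y / 2) * (1 / cosh (ln y / 2)))"
      by (simp only: integral_mult_right_zero sech_fourier of_real_mult)
    also have "exp (- ln y / 2) * (1 / cosh (ln y / 2)) = 2 / (1 + y)"
    proof -
      have "exp (ln y / 2) * exp (ln y / 2) = y" using y by (simp flip: exp_add)
      then show ?thesis
        using y by (simp add: cosh_field_def exp_minus field_simps)
    qed
    finally show ?thesis using True by simp
  qed (simp add: f_def)
  then have "(\<integral>y. (\<integral>t. f y t \<partial>lborel) \<partial>lborel) = (LINT y:{0<..<x}|lborel. of_real (2 / (1 + y)))"
    by (simp add: set_lebesgue_integral_def)
  also have "\<dots> = of_real (2 * ln (1 + x)) - of_real (2 * ln (1 + 0))"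
  proof (rule set_lebesgue_integral_Ioo_FTC)
    show "continuous_on {0..x} (\<lambda>y. complex_of_real (2 * ln (1 + y)))"
      by (intro continuous_intros) auto
    show "((\<lambda>y. complex_of_real (2 * ln (1 + y))) has_vector_derivative of_real (2 / (1 + y))) (at y)"
      if "y \<in> {0<..<x}" for y
      by (rule has_vector_derivative_of_real) (use that in \<open>auto intro!: derivative_eq_intros simp: has_real_derivative_iff_has_vector_derivative[symmetric]\<close>)
    have "set_integrable lborel {0..x} (\<lambda>y. complex_of_real (2 / (1 + y)))"
      by (rule borel_integrable_atLeastAtMost') (intro continuous_intros, auto)
    then show "set_integrable lborel {0<..<x} (\<lambda>y. complex_of_real (2 / (1 + y)))"
      by (rule set_integrable_subset) auto
  qed (use x in auto)
  finally have lhs: "(\<integral>t. (\<integral>y. f y t \<partial>lborel) \<partial>lborel) = 2 * of_real (ln (1 + x))"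
    using swap by simp
  have "(\<integral>y. f y t \<partial>lborel) = exp ((1 / 2 + \<i> * t) * of_real (ln x)) / (of_real (cosh (pi * t)) * (1 / 2 + \<i> * t))" for t
  proof -
    define w where "w = 1 / 2 + \<i> * complex_of_real t"
    have w0: "w \<noteq> 0" "Re w > 0" by (auto simp: w_def complex_eq_iff)
    have "(LINT y:{0<..<x}|lborel. exp ((w - 1) * of_real (ln y))) = of_real x powr w / w - of_real 0 powr w / w"
    proof (rule set_lebesgue_integral_Ioo_FTC)
      show "continuous_on {0..x} (\<lambda>y. complex_of_real y powr w / w)"
        using w0 by (intro continuous_intros) auto
      fix y assume y: "y \<in> {0<..<x}"
      have "((\<lambda>z. z powr w / w) has_field_derivative (w * of_real y powr (w - 1)) / w) (at (of_real y))"
        using y w0 by (intro derivative_eq_intros) auto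
      moreover have "w * of_real y powr (w - 1) / w = exp ((w - 1) * of_real (ln y))"
        using y w0 by (simp add: powr_def Ln_of_real)
      ultimately show "((\<lambda>y. complex_of_real y powr w / w) has_vector_derivative exp ((w - 1) * of_real (ln y))) (at y)"
        using has_vector_derivative_real_field by fastforce
    next
      show "set_integrable lborel {0<..<x} (\<lambda>y. exp ((w - 1) * of_real (ln y)))"
        unfolding set_integrable_def
      proof (rule Bochner_Integration.integrable_bound[OF set_integrable_inverse_sqrt[OF x, unfolded set_integrable_def]])
        show "AE y in lborel. norm (indicator {0<..<x} y *\<^sub>R exp ((w - 1) * of_real (ln y))) \<le>
            norm (indicator {0<..<x} y *\<^sub>R exp (- ln y / 2))"
          by (simp add: w_def indicator_def)
      qed measurable
    qed (use x in auto)
    also have "\<dots> = exp (w * of_real (ln x)) / w"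
      using x by (simp add: powr_def Ln_of_real)
    finally have "(LINT y:{0<..<x}|lborel. exp ((w - 1) * of_real (ln y))) = exp (w * of_real (ln x)) / w" .
    moreover have "(\<integral>y. f y t \<partial>lborel) = (LINT y:{0<..<x}|lborel. exp ((w - 1) * of_real (ln y))) / of_real (cosh (pi * t))"
      unfolding f_def set_lebesgue_integral_def
      by (subst integral_divide_zero[symmetric], rule Bochner_Integration.integral_cong)
        (simp_all add: w_def indicator_def)
    ultimately show ?thesis by (simp add: w_def mult.commute)
  qed
  with lhs show ?thesis by simp
qed

section \<open>Expectations of \<open>ln (1 + X)\<close> by moments\<close>

text \<open>From \<open>1 + x \<le> (1 + sqrt x)^2\<close>. Since \<open>sqrt x\<close> is also the
  modulus of \<open>x^(1/2 + \<i> t)\<close>, one moment of order \<open>1/2\<close> controls both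
  the logarithm and its integral representation.\<close>

lemma ln_1_plus_le: "ln (1 + x) \<le> 2 * exp (ln x / 2)" if x: "x > 0" for x :: real
proof -
  have "exp (ln x / 2) * exp (ln x / 2) = x" using x by (simp flip: exp_add)
  then have "1 + x \<le> (1 + exp (ln x / 2))\<^sup>2" by (simp add: power2_eq_square algebra_simps)
  then have "ln (1 + x) \<le> ln ((1 + exp (ln x / 2))\<^sup>2)"
    using x by (subst ln_le_cancel_iff) (auto intro!: zero_less_power add_pos_pos)
  also have "\<dots> = 2 * ln (1 + exp (ln x / 2))"
    by (subst ln_realpow) (auto simp: add_pos_pos)
  also have "\<dots> \<le> 2 * exp (ln x / 2)"
    using ln_add_one_self_le_self[of "exp (ln x / 2)"] by simp
  finally show ?thesis .
qed

text \<open>The bound \<open>\<bar>1/2 + \<i> t\<bar> \<ge> 1/2\<close> turns the modulus of the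
  double integrand into a product of functions of \<open>y\<close> and of \<open>t\<close>, so the
  order of integration can be exchanged. Positivity of \<open>X\<close> is asked only where the
  weight is nonzero, because the representation of the logarithm says nothing elsewhere.\<close>

lemma ln_expectation_mellin_barnes:
  fixes X g :: "real \<Rightarrow> real"
  assumes X[measurable]: "X \<in> borel_measurable borel" and g[measurable]: "g \<in> borel_measurable borel"
    and g0: "\<And>y. g y \<ge> 0" and pos: "\<And>y. g y \<noteq> 0 \<Longrightarrow> X y > 0"
    and int: "integrable lborel (\<lambda>y. exp (ln (X y) / 2) * g y)"
  shows "integrable lborel (\<lambda>y. ln (1 + X y) * g y)"
    and "complex_of_real (\<integral>y. ln (1 + X y) * g y \<partial>lborel) =
      1 / 2 * (\<integral>t. (\<integral>y. exp ((1 / 2 + \<i> * t) * of_real (ln (X y))) * g y \<partial>lborel) /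
        (of_real (cosh (pi * t)) * (1 / 2 + \<i> * t)) \<partial>lborel)"
proof -
  show "integrable lborel (\<lambda>y. ln (1 + X y) * g y)"
  proof (rule Bochner_Integration.integrable_bound)
    show "integrable lborel (\<lambda>y. 2 * (exp (ln (X y) / 2) * g y))" using int by simp
    have "norm (ln (1 + X y) * g y) \<le> norm (2 * (exp (ln (X y) / 2) * g y))" for y
      using ln_1_plus_le[OF pos[of y]] pos[of y] g0[of y]
      by (cases "g y = 0") (auto simp: abs_mult)
    then show "AE y in lborel. norm (ln (1 + X y) * g y) \<le> norm (2 * (exp (ln (X y) / 2) * g y))"
      by simp
  qed measurable
  define f where "f = (\<lambda>y t. exp ((1 / 2 + \<i> * complex_of_real t) * of_real (ln (X y))) * g y /
    (of_real (cosh (pi * t)) * (1 / 2 + \<i> * t)))"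
  have "(\<integral>t. (\<integral>y. f y t \<partial>lborel) \<partial>lborel) = (\<integral>y. (\<integral>t. f y t \<partial>lborel) \<partial>lborel)"
  proof (rule Fubini_product_bound)
    show "(\<lambda>(y, t). f y t) \<in> borel_measurable (lborel \<Otimes>\<^sub>M lborel)"
      unfolding f_def cosh_field_def by measurable
    show "integrable lborel (\<lambda>y. 2 * (exp (ln (X y) / 2) * g y))" using int by simp
    show "integrable lborel (\<lambda>t::real. 1 / cosh (pi * t))" by (rule integrable_sech)
    fix y t :: real
    have "1 / 2 \<le> norm (1 / 2 + \<i> * complex_of_real t)"
      using abs_Re_le_cmod[of "1 / 2 + \<i> * complex_of_real t"] by simp
    then have "exp (ln (X y) / 2) * g y / (cosh (pi * t) * norm (1 / 2 + \<i> * complex_of_real t))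
        \<le> exp (ln (X y) / 2) * g y / (cosh (pi * t) * (1 / 2))"
      using g0[of y] by (intro divide_left_mono mult_left_mono mult_pos_pos) auto
    then show "norm (f y t) \<le> 2 * (exp (ln (X y) / 2) * g y) * (1 / cosh (pi * t))"
      using g0[of y] by (simp add: f_def norm_divide norm_mult ac_simps)
  qed
  also have "(\<lambda>y. \<integral>t. f y t \<partial>lborel) = (\<lambda>y. 2 * of_real (ln (1 + X y) * g y))"
  proof
    fix y
    have "f y = (\<lambda>t. g y * (exp ((1 / 2 + \<i> * complex_of_real t) * of_real (ln (X y))) /
      (of_real (cosh (pi * t)) * (1 / 2 + \<i> * t))))"
      by (simp add: f_def fun_eq_iff)
    then have "(\<integral>t. f y t \<partial>lborel) = g y * (\<integral>t. exp ((1 / 2 + \<i> * complex_of_real t) * of_real (ln (X y))) /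
      (of_real (cosh (pi * t)) * (1 / 2 + \<i> * t)) \<partial>lborel)"
      by (simp only: integral_mult_right_zero)
    moreover have "(\<integral>t. exp ((1 / 2 + \<i> * complex_of_real t) * of_real (ln (X y))) /
      (of_real (cosh (pi * t)) * (1 / 2 + \<i> * t)) \<partial>lborel) = 2 * of_real (ln (1 + X y))" if "g y \<noteq> 0"
      unfolding ln_mellin_barnes[OF pos[OF that]] by simp
    ultimately show "(\<integral>t. f y t \<partial>lborel) = 2 * of_real (ln (1 + X y) * g y)"
      by (cases "g y = 0") simp_all
  qed
  also have "(\<integral>y. 2 * complex_of_real (ln (1 + X y) * g y) \<partial>lborel) = 2 * of_real (\<integral>y. ln (1 + X y) * g y \<partial>lborel)"
    by (simp only: integral_mult_right_zero integral_complex_of_real)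
  finally show "complex_of_real (\<integral>y. ln (1 + X y) * g y \<partial>lborel) =
      1 / 2 * (\<integral>t. (\<integral>y. exp ((1 / 2 + \<i> * t) * of_real (ln (X y))) * g y \<partial>lborel) /
        (of_real (cosh (pi * t)) * (1 / 2 + \<i> * t)) \<partial>lborel)"
    by (simp add: f_def)
qed

text \<open>The substitution \<open>u = y / k\<close> turns the moment into Euler's integral for
  \<open>Gamma (l + w)\<close>. Complex powers are written as \<open>exp (w * ln y)\<close>; the
  values of \<open>ln\<close> at \<open>y \<le> 0\<close> do no harm since the density vanishes
  there.\<close>

lemma gamma_density_moment:
  fixes l k :: real and w :: complex
  assumes l: "l > 0" and k: "k > 0" and w: "Re w \<ge> 0"
  shows "integrable lborel (\<lambda>y. exp (w * of_real (ln y)) * gamma_density l k y)"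
    and "(\<integral>y. exp (w * of_real (ln y)) * gamma_density l k y \<partial>lborel) = exp (w * of_real (ln k)) * Gamma (l + w) / Gamma l"
proof -
  define z where "z = of_real l + w"
  have z: "Re z > 0" using l w by (simp add: z_def)
  define h where "h = (\<lambda>u. indicator {0<..} u *\<^sub>R (complex_of_real u powr (z - 1) / of_real (exp u)))"
  have h_meas: "h \<in> borel_measurable borel"
  proof -
    \<comment> \<open>The exponential form makes Borel measurability evident, which allows passing
      from Lebesgue to Borel integrability.\<close>
    have "h = (\<lambda>u. indicator {0<..} u *\<^sub>R (exp ((z - 1) * of_real (ln u)) / of_real (exp u)))"
      by (auto simp: h_def fun_eq_iff indicator_def powr_def Ln_of_real)
    also have "\<dots> \<in> borel_measurable borel" by measurable
    finally show ?thesis .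
  qed
  have "integrable lebesgue h"
    using absolutely_integrable_Gamma_integral'[OF z] by (simp add: set_integrable_def h_def)
  then have h: "integrable lborel h"
    using h_meas by (subst (asm) integrable_completion) auto
  have "(LINT u:{0<..}|lborel. complex_of_real u powr (z - 1) / of_real (exp u)) = Gamma z"
    using h Gamma_integral_complex'[OF z]
    by (subst set_borel_integral_eq_integral) (auto simp: set_integrable_def h_def integral_unique)
  then have hG: "(\<integral>u. h u \<partial>lborel) = Gamma z"
    by (simp add: set_lebesgue_integral_def h_def)
  define c where "c = exp (w * of_real (ln k)) / (Gamma l * k)"
  have eq: "exp (w * of_real (ln y)) * gamma_density l k y = c * h (0 + (1 / k) * y)" for y
  proof (cases "y > 0")
    case True
    have "ln (y / k) = ln y - ln k" using True k by (simp add: ln_div)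
    then have e1: "of_real (y / k) powr (z - 1) = exp ((of_real l + w - 1) * (of_real (ln y) - of_real (ln k)))"
      using True k by (simp add: powr_def Ln_of_real z_def del: of_real_divide)
    have e2: "complex_of_real (y powr (l - 1) / k powr l) = exp (of_real ((l - 1) * ln y - l * ln k))"
      unfolding exp_of_real using True k by (simp add: powr_def exp_diff)
    have e3: "complex_of_real (1 / k) = exp (of_real (- ln k))"
      unfolding exp_of_real using k by (simp add: exp_minus inverse_eq_divide)
    have e: "exp (w * of_real (ln y)) * of_real (y powr (l - 1) / k powr l) =
      exp (w * of_real (ln k)) * of_real (1 / k) * of_real (y / k) powr (z - 1)"
      unfolding e1 e2 e3 exp_add[symmetric]
      by (rule arg_cong[of _ _ exp]) (simp add: algebra_simps)
    have "exp (w * of_real (ln y)) * gamma_density l k y =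
        exp (w * of_real (ln y)) * of_real (y powr (l - 1) / k powr l) * (1 / (Gamma l * exp (y / k)))"
      using True by (simp add: gamma_density_def exp_minus field_simps)
    also have "\<dots> = c * h (0 + (1 / k) * y)"
      unfolding e using True k by (simp add: c_def h_def)
    finally show ?thesis .
  qed (use k in \<open>auto simp: gamma_density_def h_def indicator_def zero_less_divide_iff\<close>)
  show "integrable lborel (\<lambda>y. exp (w * of_real (ln y)) * gamma_density l k y)"
    unfolding eq using k h by (intro integrable_mult_right lborel_integrable_real_affine) auto
  have "Gamma z = \<bar>1 / k\<bar> *\<^sub>R (\<integral>y. h (0 + (1 / k) * y) \<partial>lborel)"
    unfolding hG[symmetric] using k by (intro lborel_integral_real_affine) auto
  then have "(\<integral>y. h (0 + (1 / k) * y) \<partial>lborel) = k * Gamma z"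
    using k by (simp add: scaleR_conv_of_real field_simps)
  then show "(\<integral>y. exp (w * of_real (ln y)) * gamma_density l k y \<partial>lborel) = exp (w * of_real (ln k)) * Gamma (l + w) / Gamma l"
    unfolding eq integral_mult_right_zero using k
    by (simp add: c_def z_def Gamma_complex_of_real)
qed

section \<open>Growth of the integrand on vertical strips\<close>

text \<open>Triangle inequality in Euler's integral: \<open>t powr (z - 1)\<close> has modulus
  \<open>t powr (Re z - 1)\<close>.\<close>

lemma norm_Gamma_le:
  assumes "Re z > 0"
  shows "norm (Gamma z :: complex) \<le> Gamma (Re z)"
proof -
  have c: "((\<lambda>t. of_real t powr (z - 1) / of_real (exp t)) has_integral Gamma z) {0..}"
    by (rule Gamma_integral_complex[OF assms])
  have r: "((\<lambda>t. t powr (Re z - 1) / exp t) has_integral Gamma (Re z)) {0..}"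
    by (rule Gamma_integral_real[OF assms])
  have "norm (integral {0..} (\<lambda>t. complex_of_real t powr (z - 1) / of_real (exp t))) \<le>
      integral {0..} (\<lambda>t. t powr (Re z - 1) / exp t)"
    using c r by (intro integral_norm_bound_integral)
      (auto simp: has_integral_integrable norm_divide norm_powr_real_powr)
  then show ?thesis using c r by (simp add: integral_unique)
qed

text \<open>A shift by \<open>n\<close> moves the strip to \<open>Re s \<ge> 1\<close>, where
  \<open>Gamma\<close> is bounded by its values on a compact real interval. Coming back divides by
  \<open>pochhammer s n\<close>, each factor of which has modulus at least
  \<open>\<bar>Im s\<bar> \<ge> 1\<close>.\<close>

lemma Gamma_bounded_on_strip:
  "\<exists>C\<ge>0. \<forall>s. Re s \<in> {x..y} \<and> \<bar>Im s\<bar> \<ge> 1 \<longrightarrow> norm (Gamma s :: complex) \<le> C"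
proof -
  define n where "n = nat \<lceil>1 - x\<rceil>"
  have n: "x + n \<ge> 1" unfolding n_def by linarith
  have "compact (Gamma ` {x + n..y + n})"
    using n by (intro compact_continuous_image continuous_on_Gamma) (auto elim!: nonpos_Ints_cases')
  then have "bounded (Gamma ` {x + n..y + n})" by (rule compact_imp_bounded)
  then obtain C where C: "C > 0" "\<And>u. u \<in> {x + n..y + n} \<Longrightarrow> norm (Gamma u) \<le> C"
    unfolding bounded_pos by auto
  have "norm (Gamma s) \<le> C" if s: "Re s \<in> {x..y}" "\<bar>Im s\<bar> \<ge> 1" for s :: complex
  proof -
    have "s \<notin> \<int>\<^sub>\<le>\<^sub>0" using s by (auto elim!: nonpos_Ints_cases')
    then have "pochhammer s n = Gamma (s + of_nat n) / Gamma s" by (rule pochhammer_Gamma)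
    moreover have "Gamma s \<noteq> 0" using \<open>s \<notin> \<int>\<^sub>\<le>\<^sub>0\<close> by (simp add: Gamma_eq_zero_iff)
    ultimately have "norm (Gamma s) * norm (pochhammer s n) = norm (Gamma (s + of_nat n))"
      by (simp add: norm_divide)
    moreover have "norm (pochhammer s n) \<ge> 1"
      unfolding pochhammer_prod prod_norm[symmetric]
    proof (rule prod_ge_1)
      fix i
      show "1 \<le> norm (s + of_nat i)" using abs_Im_le_cmod[of "s + of_nat i"] s by simp
    qed
    then have "norm (Gamma s) * 1 \<le> norm (Gamma s) * norm (pochhammer s n)"
      by (intro mult_left_mono) auto
    moreover have "norm (Gamma (s + of_nat n)) \<le> Gamma (Re s + n)"
      using norm_Gamma_le[of "s + of_nat n"] s n by simp
    moreover have "Gamma (Re s + n) \<le> C"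
      using C(2)[of "Re s + n"] s by simp
    ultimately show ?thesis by simp
  qed
  then show ?thesis using C(1) by (intro exI[of _ C]) auto
qed

text \<open>The square of the right-hand side is
  \<open>sin^2 (Re z) + sinh^2 (Im z)\<close>.\<close>

lemma norm_sin_ge: "\<bar>sinh (Im z)\<bar> \<le> norm (sin z)" for z :: complex
proof -
  have "(cos (2 * Re z)) = 1 - 2 * (sin (Re z))\<^sup>2" by (rule cos_double_sin)
  moreover have "exp (2 * Im z) = exp (Im z) ^ 2" by (simp add: exp_double)
  ultimately have "(sinh (Im z))\<^sup>2 \<le> (norm (sin z))\<^sup>2"
    unfolding norm_sin_squared
    by (simp add: sinh_field_def exp_minus power2_eq_square field_simps)
  then show ?thesis by (metis abs_ge_self abs_le_square_iff abs_norm_cancel order_trans power2_abs)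
qed

section \<open>Evaluation of Meijer's G function on a vertical line\<close>

text \<open>The line itself is an admissible contour and witnesses existence; the deformation result
  gives uniqueness, so the definite description has a value. The tangent \<open>\<i>\<close> of the
  line cancels the \<open>\<i>\<close> of \<open>2 pi \<i>\<close>.\<close>

lemma meijer_G_vertical_line:
  fixes d :: real and m n :: nat and as bs :: "complex list" and z :: complex
    and A B :: "complex set" and f :: "complex \<Rightarrow> complex"
  defines "A \<equiv> meijer_poles_b m bs" and "B \<equiv> meijer_poles_a n as"
    and "f \<equiv> meijer_integrand m n as bs z"
  assumes real: "A \<subseteq> \<real>" "B \<subseteq> \<real>" and cl: "closed (A \<union> B)"
    and left: "\<And>p. p \<in> A \<Longrightarrow> Re p < d" and right: "\<And>p. p \<in> B \<Longrightarrow> Re p > d"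
    and holo: "f holomorphic_on - (A \<union> B)"
    and decay: "\<And>x y. \<exists>b. (b \<longlongrightarrow> 0) at_top \<and>
        (\<forall>s. Re s \<in> {x..y} \<and> \<bar>Im s\<bar> \<ge> 1 \<longrightarrow> norm (f s) \<le> b \<bar>Im s\<bar>)"
    and int: "integrable lborel (\<lambda>t. f (Complex d t))"
  shows "meijer_G m n as bs z = 1 / (2 * pi) * (\<integral>t. f (Complex d t) \<partial>lborel)"
proof -
  define J where "J = (\<integral>t. f (Complex d t) * \<i> \<partial>lborel)"
  have J: "((\<lambda>t. f (Complex d t) * \<i>) has_integral J) UNIV"
    unfolding J_def by (rule has_integral_integral_lborel) (use int in simp)
  have real_eq: "p = of_real (Re p)" if "p \<in> A \<union> B" for p
    using that real by (auto simp: complex_is_Real_iff complex_eq_iff)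
  have off: "p \<notin> range (\<lambda>t. Complex d t)" if "p \<in> A \<union> B" for p
  proof -
    have "Re p \<noteq> d" using that left[of p] right[of p] by auto
    then show ?thesis by auto
  qed
  have "left_of_contour (\<lambda>t. Complex d t) p" if "p \<in> A" for p
    using winding_number_vertical_line[of 1 d "Re p"] left[OF that] off[of p] real_eq[of p] that
    by (simp add: left_of_contour_def)
  moreover have "right_of_contour (\<lambda>t. Complex d t) p" if "p \<in> B" for p
    using winding_number_vertical_line[of "-1" d "Re p"] right[OF that] off[of p] real_eq[of p] that
    by (simp add: right_of_contour_def)
  ultimately have contour: "meijer_contour m n as bs (\<lambda>t. Complex d t)"
    by (auto simp: meijer_contour_def A_def B_def mellin_barnes_contour_vertical_line)
  have "meijer_G m n as bs z = 1 / (2 * of_real pi * \<i>) * J"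
    unfolding meijer_G_def
  proof (rule the_equality)
    show "\<exists>L. meijer_contour m n as bs L \<and>
        (\<exists>I. ((\<lambda>t. meijer_integrand m n as bs z (L t) * vector_derivative L (at t))
               has_integral I) UNIV \<and>
             1 / (2 * of_real pi * \<i>) * J = 1 / (2 * of_real pi * \<i>) * I)"
      using contour J by (intro exI[of _ "\<lambda>t. Complex d t"] conjI exI[of _ J])
        (simp_all only: vector_derivative_vertical_line f_def)
  next
    fix w
    assume "\<exists>L. meijer_contour m n as bs L \<and>
        (\<exists>I. ((\<lambda>t. meijer_integrand m n as bs z (L t) * vector_derivative L (at t))
               has_integral I) UNIV \<and> w = 1 / (2 * of_real pi * \<i>) * I)"
    then obtain L I where L: "meijer_contour m n as bs L"
      and I: "((\<lambda>t. f (L t) * vector_derivative L (at t)) has_integral I) UNIV"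
      and w: "w = 1 / (2 * of_real pi * \<i>) * I"
      unfolding f_def by blast
    have "I = J"
      using L by (intro mellin_barnes_integral_unique[OF real cl left right holo decay J _ _ _ I])
        (auto simp: meijer_contour_def A_def B_def)
    then show "w = 1 / (2 * of_real pi * \<i>) * J" using w by simp
  qed
  also have "J = (\<integral>t. f (Complex d t) \<partial>lborel) * \<i>"
    unfolding J_def by simp
  finally show ?thesis by (simp add: field_simps)
qed

section \<open>Location of the poles for real parameters\<close>

lemma meijer_poles_b_real:
  assumes "\<And>i. i < m \<Longrightarrow> bs ! i = complex_of_real (\<beta> i)" and "p \<in> meijer_poles_b m bs"
  shows "p \<in> \<real>" and "\<exists>i<m. Re p \<le> - \<beta> i"
proof -
  obtain i n where i: "i < m" "bs ! i + p = - of_nat n"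
    using assms(2) by (auto simp: meijer_poles_b_def elim!: nonpos_Ints_cases')
  then have p: "p = of_real (- real n - \<beta> i)"
    using assms(1)[OF i(1)] by (simp add: eq_diff_eq add.commute)
  then show "p \<in> \<real>" by (metis Reals_of_real)
  show "\<exists>i<m. Re p \<le> - \<beta> i" using i(1) unfolding p by (intro exI[of _ i]) auto
qed

lemma meijer_poles_a_real:
  assumes "\<And>i. i < n \<Longrightarrow> as ! i = complex_of_real (\<alpha> i)" and "p \<in> meijer_poles_a n as"
  shows "p \<in> \<real>" and "\<exists>i<n. Re p \<ge> 1 - \<alpha> i"
proof -
  obtain i j where i: "i < n" "1 - as ! i - p = - of_nat j"
    using assms(2) by (auto simp: meijer_poles_a_def elim!: nonpos_Ints_cases')
  then have p: "p = of_real (1 - \<alpha> i + real j)"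
  proof -
    have "p = 1 - as ! i + of_nat j" using i(2) by algebra
    then show ?thesis using assms(1)[OF i(1)] by simp
  qed
  then show "p \<in> \<real>" by (metis Reals_of_real)
  show "\<exists>i<n. Re p \<ge> 1 - \<alpha> i" using i(1) unfolding p by (intro exI[of _ i]) auto
qed

lemma closed_meijer_poles: "closed (meijer_poles_b m bs \<union> meijer_poles_a n as)"
proof -
  have "meijer_poles_b m bs = (\<Union>i<m. (\<lambda>s. bs ! i + s) -` \<int>\<^sub>\<le>\<^sub>0)"
    "meijer_poles_a n as = (\<Union>i<n. (\<lambda>s. 1 - as ! i - s) -` \<int>\<^sub>\<le>\<^sub>0)"
    by (auto simp: meijer_poles_b_def meijer_poles_a_def)
  moreover have "closed (\<int>\<^sub>\<le>\<^sub>0 :: complex set)"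
    by (rule closed_subset_Ints) auto
  ultimately show ?thesis
    by (auto intro!: closed_Un closed_UN closed_vimage continuous_intros)
qed

section \<open>Gamma factors depending on the detection type\<close>

text \<open>The contribution of the entries \<open>0, (r - 1) / r\<close> to the numerator. The
  other Gamma factors of the integrand depend on \<open>u = s - a\<close> only.\<close>

definition gamma_factor :: "nat \<Rightarrow> complex \<Rightarrow> complex" where
  "gamma_factor r s = (if r = 1 then Gamma s else Gamma s * Gamma (s + 1 / 2))"

text \<open>This is Gauss's multiplication formula, trivial for \<open>r = 1\<close> and Legendre's
  duplication for \<open>r = 2\<close>, where \<open>sqrt 2 * sqrt (2 pi) = 2 sqrt pi\<close>. Its
  constant is the denominator \<open>r^(1/2) (2 pi)^((r - 1) / 2)\<close> of the theorem, and its
  factor \<open>r^(- r s)\<close> explains the \<open>r^r\<close> in the argument of the G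
  function.\<close>

lemma gamma_factor_eq_Gamma_mult:
  assumes r: "r \<in> {1, 2}" and s: "Re s > 0"
  shows "gamma_factor r s = of_real (real r powr (1 / 2) * (2 * pi) powr ((real r - 1) / 2)) *
    exp (- (r * s * of_real (ln r))) * Gamma (r * s)"
proof (cases "r = 1")
  case False
  then have r: "r = 2" using r by simp
  have pos: "w \<notin> \<int>\<^sub>\<le>\<^sub>0" if "Re w > 0" for w :: complex
    using that by (auto elim!: nonpos_Ints_cases')
  have "s \<notin> \<int>\<^sub>\<le>\<^sub>0" "s + 1 / 2 \<notin> \<int>\<^sub>\<le>\<^sub>0"
    using s by (intro pos; simp)+
  then have "gamma_factor r s = exp ((1 - 2 * s) * of_real (ln 2)) * of_real (sqrt pi) * Gamma (2 * s)"
    using Gamma_legendre_duplication[of s] r by (simp add: gamma_factor_def)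
  also have "exp ((1 - 2 * s) * of_real (ln 2)) = 2 * exp (- (2 * s * of_real (ln 2)))"
  proof -
    have "(1 - 2 * s) * of_real (ln 2) = of_real (ln 2) + - (2 * s * of_real (ln 2))"
      by (simp add: algebra_simps)
    then show ?thesis by (simp only: exp_add exp_of_real) simp
  qed
  finally have e: "gamma_factor r s = 2 * exp (- (2 * s * of_real (ln 2))) * of_real (sqrt pi) * Gamma (2 * s)" .
  have "2 powr (1 / 2) * (2 * pi) powr (1 / 2) = 2 * sqrt pi"
    by (simp add: powr_half_sqrt real_sqrt_mult)
  then have k: "complex_of_real (real r powr (1 / 2) * (2 * pi) powr ((real r - 1) / 2)) = 2 * of_real (sqrt pi)"
    by (simp add: r)
  have "of_nat r = (2 :: complex)" "real r = 2" by (simp_all add: r)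
  then show ?thesis unfolding k e by (simp only: mult_ac)
next
  case True
  then show ?thesis unfolding gamma_factor_def True by simp
qed

lemma gamma_factor_bounded_on_strip:
  "\<exists>C\<ge>0. \<forall>s. Re s \<in> {x..y} \<and> \<bar>Im s\<bar> \<ge> 1 \<longrightarrow> norm (gamma_factor r s) \<le> C"
proof -
  obtain C where C: "C \<ge> 0" "\<And>s. Re s \<in> {x..y} \<Longrightarrow> \<bar>Im s\<bar> \<ge> 1 \<Longrightarrow> norm (Gamma s) \<le> C"
    using Gamma_bounded_on_strip[of x y] by blast
  obtain D where D: "D \<ge> 0" "\<And>s. Re s \<in> {x + 1/2..y + 1/2} \<Longrightarrow> \<bar>Im s\<bar> \<ge> 1 \<Longrightarrow> norm (Gamma s) \<le> D"
    using Gamma_bounded_on_strip[of "x + 1/2" "y + 1/2"] by blast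
  have "norm (gamma_factor r s) \<le> max C (C * D)" if s: "Re s \<in> {x..y}" "\<bar>Im s\<bar> \<ge> 1" for s
  proof (cases "r = 1")
    case True
    then show ?thesis using C(2)[OF s] by (simp add: gamma_factor_def)
  next
    case False
    have "norm (Gamma (s + 1 / 2)) \<le> D" by (rule D(2)) (use s in auto)
    then have "norm (Gamma s) * norm (Gamma (s + 1 / 2)) \<le> C * D"
      using C(2)[OF s] C(1) by (intro mult_mono) auto
    then show ?thesis using False by (simp add: gamma_factor_def norm_mult)
  qed
  then show ?thesis using C(1) by (intro exI[of _ "max C (C * D)"]) auto
qed

text \<open>With \<open>1 / 0 = 0\<close>, dividing by \<open>Gamma\<close> is multiplying by the
  entire function \<open>rGamma\<close>, even at the poles of \<open>Gamma\<close>. The denominator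
  thus creates no singularities.\<close>

lemma meijer_integrand_holomorphic:
  assumes z: "z \<noteq> 0"
  shows "meijer_integrand m n as bs z holomorphic_on - (meijer_poles_b m bs \<union> meijer_poles_a n as)"
proof -
  have "meijer_integrand m n as bs z = (\<lambda>s.
      (\<Prod>i<m. Gamma (bs ! i + s)) * (\<Prod>i<n. Gamma (1 - as ! i - s)) *
      ((\<Prod>i=n..<length as. rGamma (as ! i + s)) * (\<Prod>i=m..<length bs. rGamma (1 - bs ! i - s))) *
      exp (- s * Ln z))"
    using z by (simp add: fun_eq_iff meijer_integrand_def powr_def rGamma_inverse_Gamma divide_inverse
        prod_inversef[symmetric] o_def)
  then show ?thesis
    by (auto intro!: holomorphic_intros simp: meijer_poles_b_def meijer_poles_a_def)
qed

section \<open>The integrand of the capacity formula, with \<open>a = l / r\<close>\<close>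

context
  fixes r :: nat and a \<zeta> :: real and as bs :: "complex list" and f :: "complex \<Rightarrow> complex"
  assumes r: "r \<in> {1, 2}" and a: "a > 0" and \<zeta>: "\<zeta> > 0"
    and as_def: "as = map complex_of_real [- a, 1 - a]"
    and bs_def: "bs = map complex_of_real ((if r = 1 then [0] else [0, (real r - 1) / r]) @ [- a, - a])"
    and f_def: "f = meijer_integrand (r + 2) 1 as bs (complex_of_real \<zeta>)"
begin

lemma capacity_bs_nth: "i < r + 2 \<Longrightarrow> bs ! i = complex_of_real (Re (bs ! i))" "i < r + 2 \<Longrightarrow> - Re (bs ! i) \<le> a"
  using r a by (auto simp: bs_def less_Suc_eq numeral_eq_Suc)

lemma capacity_poles_b:
  assumes "p \<in> meijer_poles_b (r + 2) bs"
  shows "p \<in> \<real>" "Re p \<le> a"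
  using meijer_poles_b_real[of "r + 2" bs "\<lambda>i. Re (bs ! i)" p] capacity_bs_nth assms by force+

lemma capacity_poles_a:
  assumes "p \<in> meijer_poles_a 1 as"
  shows "p \<in> \<real>" "Re p \<ge> 1 + a"
  using meijer_poles_a_real[of 1 as "\<lambda>i. - a" p] assms by (auto simp: as_def)

lemma capacity_integrand_eq:
  assumes s: "s \<notin> meijer_poles_b (r + 2) bs"
  shows "f s = gamma_factor r s * (of_real pi / (sin (of_real pi * (s - a)) * (s - a))) *
    exp (- (s * of_real (ln \<zeta>)))"
proof -
  define u where "u = s - of_real a"
  \<comment> \<open>Exactly \<open>r\<close> entries precede the two entries \<open>- a\<close>, so
    index \<open>r\<close> is the first of them.\<close>
  have "bs ! r = - of_real a" using r by (auto simp: bs_def numeral_eq_Suc)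
  moreover have "bs ! r + s \<notin> \<int>\<^sub>\<le>\<^sub>0" using s unfolding meijer_poles_b_def by fastforce
  ultimately have u: "u \<notin> \<int>\<^sub>\<le>\<^sub>0" by (simp add: u_def)
  then have u0: "u \<noteq> 0" and G0: "Gamma u \<noteq> 0" by (auto simp: Gamma_eq_zero_iff)
  have 1: "(\<Prod>i<r + 2. Gamma (bs ! i + s)) = gamma_factor r s * (Gamma u * Gamma u)"
  proof (cases "r = 1")
    case True
    then show ?thesis
      by (simp add: bs_def gamma_factor_def u_def numeral_eq_Suc algebra_simps)
  next
    case False
    then have "r = 2" using r by simp
    then show ?thesis
      by (simp add: bs_def gamma_factor_def u_def numeral_eq_Suc algebra_simps)
  qed
  have 2: "(\<Prod>i<1. Gamma (1 - as ! i - s)) = Gamma (1 - u)"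
    by (simp add: as_def u_def algebra_simps)
  have 3: "(\<Prod>i=1..<length as. Gamma (as ! i + s)) = u * Gamma u"
    using Gamma_plus1[OF u] by (simp add: as_def u_def algebra_simps)
  have 4: "(\<Prod>i=r+2..<length bs. Gamma (1 - bs ! i - s)) = 1"
    using r by (auto simp: bs_def)
  have "f s = gamma_factor r s * (Gamma u * Gamma (1 - u) / u) * of_real \<zeta> powr (- s)"
    unfolding f_def meijer_integrand_def 1 2 3 4 using u0 G0 by (simp add: field_simps)
  also have "of_real \<zeta> powr (- s) = exp (- (s * of_real (ln \<zeta>)))"
    using \<zeta> by (simp add: powr_def Ln_of_real)
  \<comment> \<open>Valid also at the poles of \<open>Gamma (1 - u)\<close>, the positive integers
    \<open>u\<close>: both sides of the reflection formula are \<open>0\<close> there by convention.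
    Hence only the poles of the other family are excluded.\<close>
  finally show ?thesis unfolding Gamma_reflection_complex by (simp add: u_def)
qed

text \<open>On a strip with \<open>\<bar>Im s\<bar> \<ge> 1\<close> the Gamma factor and
  \<open>\<zeta>^(-s)\<close> are bounded and \<open>\<bar>s - a\<bar> \<ge> 1\<close>; the sine
  alone supplies the decay.\<close>

lemma capacity_integrand_decay:
  "\<exists>b. (b \<longlongrightarrow> 0) at_top \<and> (\<forall>s. Re s \<in> {x..y} \<and> \<bar>Im s\<bar> \<ge> 1 \<longrightarrow> norm (f s) \<le> b \<bar>Im s\<bar>)"
proof -
  obtain C where C: "C \<ge> 0" "\<And>s. Re s \<in> {x..y} \<Longrightarrow> \<bar>Im s\<bar> \<ge> 1 \<Longrightarrow> norm (gamma_factor r s) \<le> C"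
    using gamma_factor_bounded_on_strip[of x y r] by blast
  define K where "K = exp ((\<bar>x\<bar> + \<bar>y\<bar>) * \<bar>ln \<zeta>\<bar>)"
  have "norm (f s) \<le> C * pi * K / sinh (pi * \<bar>Im s\<bar>)" if s: "Re s \<in> {x..y}" "\<bar>Im s\<bar> \<ge> 1" for s
  proof -
    have "s \<notin> meijer_poles_b (r + 2) bs"
      using capacity_poles_b(1)[of s] s by (auto simp: complex_is_Real_iff)
    then have "norm (f s) = norm (gamma_factor r s) *
        (pi / (norm (sin (of_real pi * (s - a))) * norm (s - a))) * exp (- (Re s * ln \<zeta>))"
      by (simp add: capacity_integrand_eq norm_mult norm_divide)
    also have "\<dots> \<le> C * (pi / (sinh (pi * \<bar>Im s\<bar>) * 1)) * K"
    proof (intro mult_mono divide_left_mono mult_pos_pos)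
      show "norm (gamma_factor r s) \<le> C" by (rule C(2)[OF s])
      have pos: "sinh (pi * \<bar>Im s\<bar>) > 0" using s by simp
      have "\<bar>sinh (pi * Im s)\<bar> = sinh (pi * \<bar>Im s\<bar>)"
        using pos by (cases "Im s \<ge> 0") auto
      then show le: "sinh (pi * \<bar>Im s\<bar>) \<le> norm (sin (of_real pi * (s - a)))"
        using norm_sin_ge[of "of_real pi * (s - a)"] by simp
      show le': "1 \<le> norm (s - a)" using abs_Im_le_cmod[of "s - a"] s by simp
      show "0 < norm (sin (of_real pi * (s - a)))" "0 < norm (s - a)" using le le' pos by linarith+
      have "\<bar>Re s * ln \<zeta>\<bar> \<le> (\<bar>x\<bar> + \<bar>y\<bar>) * \<bar>ln \<zeta>\<bar>"
        unfolding abs_mult using s by (intro mult_right_mono) auto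
      then show "exp (- (Re s * ln \<zeta>)) \<le> K" unfolding K_def by simp
    qed (use C(1) s in auto)
    finally show ?thesis by (simp add: mult_ac)
  qed
  then show ?thesis
    by (intro exI[of _ "\<lambda>T. C * pi * K / sinh (pi * T)"] conjI inverse_sinh_tendsto_0) auto
qed

lemma capacity_integrand_line:
  "f (Complex (a + 1 / 2) t) = gamma_factor r (Complex (a + 1 / 2) t) *
     (of_real pi / (of_real (cosh (pi * t)) * (1 / 2 + \<i> * t))) *
     exp (- (Complex (a + 1 / 2) t * of_real (ln \<zeta>)))"
proof -
  let ?s = "Complex (a + 1 / 2) t"
  have u: "?s - a = 1 / 2 + \<i> * t" by (simp add: complex_eq_iff)
  have "sin (of_real pi * (1 / 2 + \<i> * t)) = cos (\<i> * of_real (pi * t))"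
    by (simp add: sin_cos_eq algebra_simps)
  also have "\<dots> = of_real (cosh (pi * t))"
    by (simp add: cosh_field_def exp_of_real flip: cosh_conv_cos of_real_mult of_real_minus)
  finally have "sin (of_real pi * (?s - a)) = of_real (cosh (pi * t))"
    by (simp only: u)
  moreover have "?s \<notin> meijer_poles_b (r + 2) bs"
    using capacity_poles_b(2)[of ?s] by auto
  ultimately show ?thesis using capacity_integrand_eq[of ?s] u by simp
qed

lemma capacity_integrand_line_integrable: "integrable lborel (\<lambda>t. f (Complex (a + 1 / 2) t))"
proof (rule Bochner_Integration.integrable_bound)
  let ?d = "a + 1 / 2"
  \<comment> \<open>The maximum covers both detection types; on the line each Gamma value is
    dominated by the one at its real part.\<close>
  define C where "C = max (Gamma ?d) (Gamma ?d * Gamma (?d + 1 / 2))"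
  define K where "K = C * (2 * pi) * exp (- (?d * ln \<zeta>))"
  show "integrable lborel (\<lambda>t. K * (1 / cosh (pi * t)))"
    by (intro integrable_mult_right integrable_sech)
  have "f holomorphic_on - (meijer_poles_b (r + 2) bs \<union> meijer_poles_a 1 as)"
    unfolding f_def using \<zeta> by (intro meijer_integrand_holomorphic) auto
  then have "continuous_on (- (meijer_poles_b (r + 2) bs \<union> meijer_poles_a 1 as)) f"
    by (rule holomorphic_on_imp_continuous_on)
  moreover have "continuous_on UNIV (\<lambda>t. Complex ?d t)"
    unfolding Complex_eq by (intro continuous_intros)
  moreover have "range (\<lambda>t. Complex ?d t) \<subseteq> - (meijer_poles_b (r + 2) bs \<union> meijer_poles_a 1 as)"
    using capacity_poles_b(2) capacity_poles_a(2) by fastforce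
  ultimately have "continuous_on UNIV (\<lambda>t. f (Complex ?d t))"
    by (rule continuous_on_compose2)
  then show "(\<lambda>t. f (Complex ?d t)) \<in> borel_measurable lborel"
    by (simp add: borel_measurable_continuous_onI)
  have "norm (f (Complex ?d t)) \<le> norm (K * (1 / cosh (pi * t)))" for t
  proof -
    let ?s = "Complex ?d t"
    have pos: "Gamma ?d > 0" "Gamma (?d + 1 / 2) > 0" using a by (auto intro!: Gamma_real_pos)
    have 1: "norm (Gamma ?s) \<le> Gamma ?d" "norm (Gamma (?s + 1 / 2)) \<le> Gamma (?d + 1 / 2)"
      using norm_Gamma_le[of ?s] norm_Gamma_le[of "?s + 1 / 2"] a by simp_all
    then have "norm (Gamma ?s) * norm (Gamma (?s + 1 / 2)) \<le> Gamma ?d * Gamma (?d + 1 / 2)"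
      using pos by (intro mult_mono) auto
    then have G: "norm (gamma_factor r ?s) \<le> C"
      using 1(1) by (auto simp: gamma_factor_def C_def norm_mult)
    have h: "1 / 2 \<le> norm (1 / 2 + \<i> * complex_of_real t)"
      using abs_Re_le_cmod[of "1 / 2 + \<i> * complex_of_real t"] by simp
    then have h0: "norm (1 / 2 + \<i> * complex_of_real t) > 0" by linarith
    have C0: "C \<ge> 0" using pos by (simp add: C_def)
    have "norm (f ?s) = norm (gamma_factor r ?s) *
        (pi / (cosh (pi * t) * norm (1 / 2 + \<i> * complex_of_real t))) * exp (- (?d * ln \<zeta>))"
      unfolding capacity_integrand_line by (simp add: norm_mult norm_divide)
    also have "\<dots> \<le> C * (pi / (cosh (pi * t) * (1 / 2))) * exp (- (?d * ln \<zeta>))"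
      using G C0 h h0 by (intro mult_right_mono mult_mono divide_left_mono mult_left_mono mult_pos_pos) auto
    also have "\<dots> = K * (1 / cosh (pi * t))" by (simp add: K_def)
    also have "\<dots> \<le> norm (K * (1 / cosh (pi * t)))" unfolding real_norm_def by (rule abs_ge_self)
    finally show ?thesis .
  qed
  then show "AE t in lborel. norm (f (Complex ?d t)) \<le> norm (K * (1 / cosh (pi * t)))" by simp
qed

lemma meijer_G_eq_line_integral:
  "meijer_G (r + 2) 1 as bs (complex_of_real \<zeta>) = 1 / (2 * pi) * (\<integral>t. f (Complex (a + 1 / 2) t) \<partial>lborel)"
  unfolding f_def
proof (rule meijer_G_vertical_line)
  show "meijer_integrand (r + 2) 1 as bs (complex_of_real \<zeta>) holomorphic_on
      - (meijer_poles_b (r + 2) bs \<union> meijer_poles_a 1 as)"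
    using \<zeta> by (intro meijer_integrand_holomorphic) auto
  show "Re p < a + 1 / 2" if "p \<in> meijer_poles_b (r + 2) bs" for p using capacity_poles_b(2)[OF that] by simp
  show "Re p > a + 1 / 2" if "p \<in> meijer_poles_a 1 as" for p using capacity_poles_a(2)[OF that] by simp
qed (use capacity_poles_b(1) capacity_poles_a(1) closed_meijer_poles capacity_integrand_decay[unfolded f_def]
    capacity_integrand_line_integrable[unfolded f_def] in auto)

text \<open>Put \<open>s = a + w\<close> with \<open>w = 1/2 + \<i> t\<close>. Then
  \<open>\<zeta>^(-s)\<close> and \<open>r^(- r s)\<close> together are
  \<open>exp ((a + w) * Q)\<close>, whose part \<open>exp (a * Q)\<close> leaves the integral. The
  \<open>pi\<close> over the sine reduces \<open>1 / (2 pi)\<close> to the \<open>1 / 2\<close> of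
  the representation of the logarithm, so the last factor has the form of an expected
  logarithm.\<close>

lemma meijer_G_capacity_kernel:
  defines "Q \<equiv> - ln \<zeta> - r * ln r"
  shows "meijer_G (r + 2) 1 as bs (complex_of_real \<zeta>) =
    of_real (real r powr (1 / 2) * (2 * pi) powr ((real r - 1) / 2) * exp (a * Q)) *
    (1 / 2 * (\<integral>t. exp ((1 / 2 + \<i> * t) * of_real Q) * Gamma (of_real (a * r) + r * (1 / 2 + \<i> * t)) /
      (of_real (cosh (pi * t)) * (1 / 2 + \<i> * t)) \<partial>lborel))"
proof -
  define C where "C = real r powr (1 / 2) * (2 * pi) powr ((real r - 1) / 2)"
  define h where "h = (\<lambda>t. exp ((1 / 2 + \<i> * complex_of_real t) * of_real Q) *
    Gamma (of_real (a * r) + r * (1 / 2 + \<i> * t)) / (of_real (cosh (pi * t)) * (1 / 2 + \<i> * t)))"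
  have "f (Complex (a + 1 / 2) t) = of_real (C * pi * exp (a * Q)) * h t" for t
  proof -
    let ?s = "Complex (a + 1 / 2) t"
    have s: "?s = of_real a + (1 / 2 + \<i> * t)" by (simp add: complex_eq_iff)
    let ?G = "Gamma (of_real (a * r) + r * (1 / 2 + \<i> * complex_of_real t))"
    have G: "Gamma (r * ?s) = ?G"
      unfolding s by (rule arg_cong[of _ _ Gamma]) (simp add: algebra_simps)
    have g: "gamma_factor r ?s = of_real C * exp (- (r * ?s * of_real (ln r))) * ?G"
      unfolding C_def G[symmetric] by (rule gamma_factor_eq_Gamma_mult[OF r]) (use a in simp)
    have "f ?s = of_real C * (exp (- (r * ?s * of_real (ln r))) * exp (- (?s * of_real (ln \<zeta>)))) *
        ?G * (of_real pi / (of_real (cosh (pi * t)) * (1 / 2 + \<i> * t)))"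
      unfolding capacity_integrand_line g by (simp only: mult_ac)
    also have "exp (- (r * ?s * of_real (ln r))) * exp (- (?s * of_real (ln \<zeta>))) =
        of_real (exp (a * Q)) * exp ((1 / 2 + \<i> * t) * of_real Q)"
      unfolding exp_of_real[symmetric] exp_add[symmetric] s
      by (rule arg_cong[of _ _ exp]) (simp add: Q_def algebra_simps)
    finally have "f ?s = of_real C * (of_real (exp (a * Q)) * exp ((1 / 2 + \<i> * t) * of_real Q)) *
        ?G * (of_real pi / (of_real (cosh (pi * t)) * (1 / 2 + \<i> * t)))" .
    then show ?thesis by (simp add: h_def)
  qed
  then have "meijer_G (r + 2) 1 as bs (complex_of_real \<zeta>) =
      1 / (2 * pi) * (of_real (C * pi * exp (a * Q)) * (\<integral>t. h t \<partial>lborel))"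
    unfolding meijer_G_eq_line_integral by (simp only: integral_mult_right_zero)
  also have "\<dots> = of_real (C * exp (a * Q)) * (1 / 2 * (\<integral>t. h t \<partial>lborel))"
    by simp
  finally show ?thesis by (simp only: C_def h_def)
qed

end

section \<open>The channel capacity\<close>

lemma gamma_density_nonneg: "l > 0 \<Longrightarrow> k > 0 \<Longrightarrow> 0 \<le> gamma_density l k y"
  using Gamma_real_pos[of l] by (simp add: gamma_density_def)

lemma gamma_density_measurable: "gamma_density l k \<in> borel_measurable borel"
  unfolding gamma_density_def by measurable

text \<open>\<open>Q\<close> is the logarithm of \<open>\<mu> (k / E)^r\<close>. The moment of
  \<open>X\<close> of order \<open>v\<close> is the Gamma moment of order \<open>r v\<close>, hence
  \<open>exp (v * Q) * Gamma (l + r v) / Gamma l\<close>.\<close>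

lemma ln_expectation_gamma:
  fixes l k \<mu> E :: real and r :: nat
  assumes l: "l > 0" and k: "k > 0" and \<mu>: "\<mu> > 0" and E: "E > 0"
  defines "X \<equiv> \<lambda>y. \<mu> * (y / E) ^ r" and "Q \<equiv> ln \<mu> + r * ln k - r * ln E"
  shows "integrable lborel (\<lambda>y. ln (1 + X y) * gamma_density l k y)"
    and "complex_of_real (\<integral>y. ln (1 + X y) * gamma_density l k y \<partial>lborel) * of_real (Gamma l) =
      1 / 2 * (\<integral>t. exp ((1 / 2 + \<i> * t) * of_real Q) * Gamma (of_real l + r * (1 / 2 + \<i> * t)) /
      (of_real (cosh (pi * t)) * (1 / 2 + \<i> * t)) \<partial>lborel)"
proof -
  let ?g = "gamma_density l k"
  have Xm: "X \<in> borel_measurable borel" unfolding X_def by measurable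
  have lnX: "ln (X y) = (ln \<mu> - r * ln E) + r * ln y" if "y > 0" for y
    using that \<mu> E by (simp add: X_def ln_mult ln_div ln_realpow algebra_simps)
  have exp_X: "exp (v * of_real (ln (X y))) * ?g y =
      exp (v * of_real (ln \<mu> - r * ln E)) * (exp (r * v * of_real (ln y)) * ?g y)" for v :: complex and y
  proof (cases "y > 0")
    case True
    have "v * of_real (ln (X y)) = v * of_real (ln \<mu> - r * ln E) + r * v * of_real (ln y)"
      unfolding lnX[OF True] by (simp add: algebra_simps)
    then show ?thesis by (simp only: exp_add mult.assoc)
  qed (simp add: gamma_density_def)
  have pos: "X y > 0" if "?g y \<noteq> 0" for y
    using that \<mu> E by (auto simp: X_def gamma_density_def split: if_splits)
  \<comment> \<open>The real moment of order \<open>1/2\<close> is read off from the complex one at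
    \<open>v = 1/2\<close> by taking norms.\<close>
  have "integrable lborel (\<lambda>y. exp (of_real (1 / 2) * of_real (ln (X y))) * complex_of_real (?g y))"
    unfolding exp_X by (intro integrable_mult_right gamma_density_moment[OF l k]) auto
  then have "integrable lborel (\<lambda>y. norm (exp (of_real (1 / 2) * of_real (ln (X y))) * complex_of_real (?g y)))"
    by (rule integrable_norm)
  then have int: "integrable lborel (\<lambda>y. exp (ln (X y) / 2) * ?g y)"
    using gamma_density_nonneg[OF l k] by (simp add: norm_mult)
  note E = ln_expectation_mellin_barnes[OF Xm gamma_density_measurable gamma_density_nonneg[OF l k] pos int]
  show "integrable lborel (\<lambda>y. ln (1 + X y) * ?g y)" by (rule E(1))
  have G: "complex_of_real (Gamma l) \<noteq> 0" using Gamma_real_pos[OF l] by simp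
  have inner: "(\<integral>y. exp ((1 / 2 + \<i> * t) * of_real (ln (X y))) * ?g y \<partial>lborel) =
      exp ((1 / 2 + \<i> * t) * of_real Q) * Gamma (of_real l + r * (1 / 2 + \<i> * t)) / Gamma l" for t :: real
  proof -
    let ?v = "1 / 2 + \<i> * complex_of_real t"
    have "(\<integral>y. exp (?v * of_real (ln (X y))) * ?g y \<partial>lborel) =
      exp (?v * of_real (ln \<mu> - r * ln E)) * (exp (r * ?v * of_real (ln k)) * Gamma (l + r * ?v) / Gamma l)"
      unfolding exp_X integral_mult_right_zero
      by (subst gamma_density_moment(2)[OF l k]) (auto simp: Gamma_complex_of_real)
    also have "exp (?v * of_real (ln \<mu> - r * ln E)) * (exp (r * ?v * of_real (ln k)) * Gamma (l + r * ?v) / Gamma l)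
      = (exp (?v * of_real (ln \<mu> - r * ln E)) * exp (r * ?v * of_real (ln k))) * Gamma (l + r * ?v) / Gamma l"
      by simp
    also have "exp (?v * of_real (ln \<mu> - r * ln E)) * exp (r * ?v * of_real (ln k)) = exp (?v * of_real Q)"
      unfolding exp_add[symmetric] by (rule arg_cong[of _ _ exp]) (simp add: Q_def algebra_simps)
    finally show ?thesis .
  qed
  have "complex_of_real (\<integral>y. ln (1 + X y) * ?g y \<partial>lborel) = 1 / 2 *
    (\<integral>t. (\<integral>y. exp ((1 / 2 + \<i> * t) * of_real (ln (X y))) * ?g y \<partial>lborel) /
      (of_real (cosh (pi * t)) * (1 / 2 + \<i> * t)) \<partial>lborel)"
    by (rule E(2))
  also have "\<dots> = 1 / 2 * (\<integral>t. exp ((1 / 2 + \<i> * t) * of_real Q) * Gamma (of_real l + r * (1 / 2 + \<i> * t)) / Gamma l /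
      (of_real (cosh (pi * t)) * (1 / 2 + \<i> * t)) \<partial>lborel)"
    by (simp only: inner)
  also have "(\<lambda>t. exp ((1 / 2 + \<i> * complex_of_real t) * of_real Q) * Gamma (of_real l + r * (1 / 2 + \<i> * t)) / Gamma l /
      (of_real (cosh (pi * t)) * (1 / 2 + \<i> * t))) =
    (\<lambda>t. exp ((1 / 2 + \<i> * complex_of_real t) * of_real Q) * Gamma (of_real l + r * (1 / 2 + \<i> * t)) /
      (of_real (cosh (pi * t)) * (1 / 2 + \<i> * t)) / Gamma l)"
    by (simp add: fun_eq_iff)
  finally show "complex_of_real (\<integral>y. ln (1 + X y) * ?g y \<partial>lborel) * of_real (Gamma l) =
      1 / 2 * (\<integral>t. exp ((1 / 2 + \<i> * t) * of_real Q) * Gamma (of_real l + r * (1 / 2 + \<i> * t)) /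
      (of_real (cosh (pi * t)) * (1 / 2 + \<i> * t)) \<partial>lborel)"
    using G by (simp only: integral_divide_zero) simp
qed

theorem mainTheorem5:
  fixes P :: "'w measure"
    and M Mbar :: "'w \<Rightarrow> real"
    and f :: "real \<Rightarrow> real"
    and E V l k \<mu> \<Lambda>1 \<Lambda>2 :: real
    and N r :: nat
  assumes "prob_space P"
    and "M \<in> borel_measurable P"
    and "AE \<omega> in P. M \<omega> > 0"
    and "integrable P M"
    and "integrable P (\<lambda>\<omega>. (M \<omega>)\<^sup>2)"
    and "E = prob_space.expectation P M" and "E > 0"
    and "V = prob_space.variance P M" and "V > 0"
    and "N \<ge> 1"
    and "l = real N * E\<^sup>2 / V"
    and "k = V / E"
    and "distributed P lborel Mbar (\<lambda>y. ennreal (gamma_density l k y))"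
    and "r \<in> {1, 2}"
    and "\<mu> > 0"
    and "distributed P lborel (\<lambda>\<omega>. \<mu> * (Mbar \<omega> / E) ^ r) (\<lambda>x. ennreal (f x))"
    and "\<And>x. f x \<ge> 0"
    and "\<Lambda>1 = E powr l / (Gamma l * k powr l)"
    and "\<Lambda>2 = E / k"
  shows "set_integrable lborel {0<..} (\<lambda>x. ln (1 + x) * f x) \<and>
    complex_of_real (avg_channel_capacity f) =
      complex_of_real (\<Lambda>1 * \<mu> powr (- l / r) /
        (2 * ln 2 * real r powr (1 / 2) * (2 * pi) powr ((real r - 1) / 2))) *
      meijer_G (r + 2) 1
        (map complex_of_real [- l / r, 1 - l / r])
        (map complex_of_real
          ((if r = 1 then [0] else [0, (real r - 1) / r]) @ [- l / r, - l / r]))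
        (complex_of_real (\<Lambda>2 ^ r / (\<mu> * real r ^ r)))"
proof -
  note E = assms(7) and V = assms(9) and N = assms(10) and l_def = assms(11)
    and k_def = assms(12) and Mbar = assms(13) and r = assms(14) and \<mu> = assms(15)
    and f = assms(16) and f0 = assms(17) and \<Lambda>1 = assms(18) and \<Lambda>2 = assms(19)
  have l: "l > 0" using E V N by (simp add: l_def)
  have k: "k > 0" using E V by (simp add: k_def)
  have r0: "r > 0" using r by auto
  define X where "X = (\<lambda>y. \<mu> * (y / E) ^ r)"
  \<comment> \<open>The indicator is part of the test function so that the transfer formulas for
    densities, which integrate over the whole line, apply to it.\<close>
  define g where "g = (\<lambda>x::real. indicator {0<..} x * ln (1 + x))"
  have gm: "g \<in> borel_measurable lborel" unfolding g_def by measurable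
  have gXm: "(\<lambda>y. g (X y)) \<in> borel_measurable lborel" unfolding g_def X_def by measurable
  \<comment> \<open>For \<open>y > 0\<close> also \<open>X y > 0\<close> and the indicator is
    \<open>1\<close>; for \<open>y \<le> 0\<close> the density vanishes.\<close>
  have dens: "gamma_density l k y * g (X y) = ln (1 + X y) * gamma_density l k y" for y
    using \<mu> E by (auto simp: gamma_density_def g_def X_def indicator_def)
  have G: "integrable lborel (\<lambda>y. ln (1 + X y) * gamma_density l k y)"
    unfolding X_def by (rule ln_expectation_gamma(1)[OF l k \<mu> E])
  define I where "I = (\<integral>y. ln (1 + X y) * gamma_density l k y \<partial>lborel)"
  have fg: "indicator {0<..} x *\<^sub>R (ln (1 + x) * f x) = f x * g x" for x
    by (simp add: g_def)
  have "integrable P (\<lambda>\<omega>. g (X (Mbar \<omega>)))"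
    using distributed_integrable[OF Mbar gXm gamma_density_nonneg[OF l k]] G
    by (simp add: dens)
  then have "integrable lborel (\<lambda>x. f x * g x)"
    using distributed_integrable[OF f gm f0] by (simp add: X_def)
  then have int: "set_integrable lborel {0<..} (\<lambda>x. ln (1 + x) * f x)"
    unfolding set_integrable_def fg .
  have "(LINT x:{0<..}|lborel. ln (1 + x) * f x) = (\<integral>x. f x * g x \<partial>lborel)"
    unfolding set_lebesgue_integral_def fg ..
  also have "\<dots> = (\<integral>\<omega>. g (X (Mbar \<omega>)) \<partial>P)"
    using distributed_integral[OF f gm f0] by (simp add: X_def)
  also have "\<dots> = (\<integral>y. gamma_density l k y * g (X y) \<partial>lborel)"
    using distributed_integral[OF Mbar gXm gamma_density_nonneg[OF l k]] by simp
  also have "\<dots> = I" unfolding dens I_def ..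
  finally have capacity: "avg_channel_capacity f = 1 / (2 * ln 2) * I"
    by (simp add: avg_channel_capacity_def)
  define a where "a = l / r"
  define \<zeta> where "\<zeta> = \<Lambda>2 ^ r / (\<mu> * real r ^ r)"
  define C where "C = real r powr (1 / 2) * (2 * pi) powr ((real r - 1) / 2)"
  define Q where "Q = ln \<mu> + r * ln k - r * ln E"
  have a: "a > 0" and ar: "a * r = l" using l r0 by (simp_all add: a_def)
  have \<zeta>: "\<zeta> > 0" using E k \<mu> r0 by (simp add: \<zeta>_def \<Lambda>2)
  have "ln \<zeta> = r * (ln E - ln k) - (ln \<mu> + r * ln r)"
    using E k \<mu> r0 by (simp add: \<zeta>_def \<Lambda>2 ln_div ln_mult ln_realpow)
  \<comment> \<open>The factor \<open>r^r\<close> in the denominator of \<open>\<zeta>\<close>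
    cancels the one left by the multiplication formula, so both sides of the identity share the same
    \<open>Q\<close>.\<close>
  then have Q: "- ln \<zeta> - r * ln r = Q" by (simp add: Q_def algebra_simps)
  let ?bs = "map complex_of_real ((if r = 1 then [0] else [0, (real r - 1) / r]) @ [- a, - a])"
  have "meijer_G (r + 2) 1 (map complex_of_real [- a, 1 - a]) ?bs (of_real \<zeta>) =
      of_real (C * exp (a * Q)) * (of_real I * of_real (Gamma l))"
    unfolding I_def X_def ln_expectation_gamma(2)[OF l k \<mu> E, of r] C_def Q_def[symmetric]
    using meijer_G_capacity_kernel[OF r a \<zeta> refl refl refl] by (simp only: Q ar)
  then have "of_real (\<Lambda>1 * \<mu> powr (- l / r) / (2 * ln 2 * C)) *
      meijer_G (r + 2) 1 (map complex_of_real [- a, 1 - a]) ?bs (of_real \<zeta>) =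
    complex_of_real (\<Lambda>1 * \<mu> powr (- l / r) / (2 * ln 2 * C) * (C * exp (a * Q) * (I * Gamma l)))"
    by (simp only: of_real_mult)
  \<comment> \<open>As \<open>a * r = l\<close>, \<open>exp (a * Q)\<close> is
    \<open>\<mu>^a * (k / E)^l\<close>. This is the inverse of
    \<open>\<Lambda>1 * \<mu>^(-a) * Gamma l\<close>, so all parameters cancel except
    \<open>1 / (2 ln 2)\<close>.\<close>
  also have "\<Lambda>1 * \<mu> powr (- l / r) / (2 * ln 2 * C) * (C * exp (a * Q) * (I * Gamma l)) = 1 / (2 * ln 2) * I"
  proof -
    have C: "C \<noteq> 0" using r0 by (simp add: C_def)
    have G0: "Gamma l \<noteq> 0" using Gamma_real_pos[OF l] by simp
    have "a * Q = a * ln \<mu> + l * ln k - l * ln E"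
      by (simp add: Q_def algebra_simps flip: ar)
    then have "exp (a * Q) = \<mu> powr a * k powr l / E powr l"
      using E k \<mu> by (simp add: powr_def exp_add exp_diff)
    moreover have "\<mu> powr (- l / r) = 1 / \<mu> powr a"
      by (simp add: a_def powr_minus_divide)
    ultimately have e: "\<Lambda>1 * \<mu> powr (- l / r) * exp (a * Q) * Gamma l = 1"
      using E k \<mu> G0 by (simp add: \<Lambda>1)
    have "\<Lambda>1 * \<mu> powr (- l / r) / (2 * ln 2 * C) * (C * exp (a * Q) * (I * Gamma l)) =
        (\<Lambda>1 * \<mu> powr (- l / r) * exp (a * Q) * Gamma l) * (1 / (2 * ln 2) * I)"
      using C by (simp add: field_simps)
    then show ?thesis unfolding e by simp
  qed
  finally have "complex_of_real (avg_channel_capacity f) =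
      of_real (\<Lambda>1 * \<mu> powr (- l / r) / (2 * ln 2 * C)) *
      meijer_G (r + 2) 1 (map complex_of_real [- a, 1 - a]) ?bs (of_real \<zeta>)"
    unfolding capacity ..
  moreover have "- l / r = - a" "1 - l / r = 1 - a" by (simp_all add: a_def)
  ultimately have "complex_of_real (avg_channel_capacity f) =
      of_real (\<Lambda>1 * \<mu> powr (- l / r) / (2 * ln 2 * C)) *
      meijer_G (r + 2) 1 (map complex_of_real [- l / r, 1 - l / r])
        (map complex_of_real ((if r = 1 then [0] else [0, (real r - 1) / r]) @ [- l / r, - l / r])) (of_real \<zeta>)"
    by (simp only:)
  then show ?thesis
    using int unfolding C_def \<zeta>_def by (simp only: mult.assoc simp_thms)
qed

end
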